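(* There exist a (sufficiently large) constant $\lambda_\zeta>0$ depending only on $\zeta$ and a constant $c>0$ such that the following holds in the setting of the context. Let $\delta\in(0,1)$, let $\Lambda=\{\lambda_1,\dots,\lambda_L\}\subset[\lambda_\zeta,\infty)$ be a decreasing grid, and assume $\underline\omega>0$. Then, with probability at least $1-c\delta$, the following inequality holds for all $\lambda\in\Lambda$ simultaneously: $$\bigl(\eta_n+(\lambda-\lambda_\zeta)C_{\min}\bigr)\Delta^+(\widehat S_\lambda)+\Bigl(\frac{n}{2\sigma^2}\underline\omega\beta_{\min}^2-\eta_n-\lambda C^*_{\max}-\lambda_\zeta\log s^*\Bigr)\Delta^-(\widehat S_\lambda)\le\lambda_\zeta\log\Bigl(\frac L\delta\Bigr).$$
   Context: Model: $X\in\mathbb R^{n\times p}$ is a fixed design, $y=X\beta^*+\varepsilon$, where $\beta^*$ has support $S^*$, $s^*=|S^*|\ge1$, $\beta_{\min}=\min_{j\in S^*}|\beta_j^*|$. The $\varepsilon_i$ are independent, mean zero, $\mathbb E(\varepsilon_i^2)=\sigma^2$, with $\Pr(|\varepsilon_i/\sigma|>t)\le2\exp\{-(t/\zeta)^2\}$ for all $t\ge2$. Candidates: $\mathcal M_n=2^{[p]}$. Each variable $i\in[p]$ has a rank $r_i\in[p]$ (a given ranking of the $p$ variables) and code length $C_i=\log^*(r_i)$, $\log^*(t)=\log t+2\log\log(t+2)$; $C_S=\sum_{i\in S}C_i$. With $s=|S|$, $P_S$ the orthogonal projection onto $\mathrm{Col}(X_S)$, $\mathrm{RSS}(S)=\|(\mathrm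 I_n-P_S)y\|_2^2$ and $\eta_n>0$, $\mathrm{DCIC}_\lambda(S)=\mathrm{RSS}(S)/\sigma^2+\eta_ns+\lambda C_S$, and $\widehat S_\lambda$ is a minimizer of $\mathrm{DCIC}_\lambda$ over $\mathcal M_n$. $\Delta^+(S)=|S\setminus S^*|$ (false positives), $\Delta^-(S)=|S^*\setminus S|$ (false negatives). $\mathcal M_{\mathrm{sub}}=\{S:S\subsetneq S^*\}$; $\mathcal M_{\mathrm w}$ is the set of $S$ with neither $S\subseteq S^*$ nor $S^*\subseteq S$. $C_{\min}=\min_{i\in[p]\setminus S^*}C_i$, $C^*_{\max}=\max_{i\in S^*}C_i$. For $\lambda\in\Lambda$, $$\mathcal L_\lambda=\bigl\{S\in\mathcal M_{\mathrm{sub}}\cup\mathcal M_{\mathrm w}:(\eta_n+(\lambda-\lambda_\zeta)C_{\min})\Delta^+(S)-(\eta_n+\lambda C^*_{\max}+\lambda_\zeta\log s^* )\Delta^-(S)\le\lambda_\zeta\log(L/\delta)\bigr\},$$ $$\omega_\lambda=\inf_{S\in\mathcal L_\lambda}\lambda_{\min}\Bigl(\frac1nX_{S^*\setminus S}^\top(\mathrm I_n-P_S)X_{S^*\setminus S}\Bigr),\qquad\underline\omega=\min_{\lambda\in\Lambda}\omega_\lambda .$$ *)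

theory Defs
  imports
    "HOL-Probability.Probability"
    "Jordan_Normal_Form.Spectral_Radius"
    "Jordan_Normal_Form.DL_Submatrix"
begin

text \<open>
  Vectors and matrices are those of \<open>Jordan_Normal_Form\<close>, whose dimensions are numbers rather than
  types; observations and variables are indexed from 0, i.e. \<open>[p]\<close> is \<open>{..<p}\<close>.  Ranks, however,
  start at 1.
\<close>

definition log_star :: "real \<Rightarrow> real" where
  "log_star t = ln t + 2 * ln (ln (t + 2))"

definition code_len :: "(nat \<Rightarrow> nat) \<Rightarrow> nat \<Rightarrow> real" where
  "code_len r i = log_star (real (r i))"

definition support :: "real Matrix.vec \<Rightarrow> nat set" where
  "support b = {j. j < dim_vec b \<and> vec_index b j \<noteq> 0}"

definition beta_min :: "real Matrix.vec \<Rightarrow> real" where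
  "beta_min b = (MIN j\<in>support b. \<bar>vec_index b j\<bar>)"

text \<open>The submatrix \<open>X\<^sub>S\<close> of the columns with index in \<open>S\<close>, in increasing order.\<close>

definition col_sub :: "real mat \<Rightarrow> nat set \<Rightarrow> real mat" where
  "col_sub X S = submatrix X UNIV S"

definition orth_proj :: "nat \<Rightarrow> real Matrix.vec set \<Rightarrow> real mat" where
  "orth_proj n V = (THE P. P \<in> carrier_mat n n \<and>
     (\<forall>v\<in>carrier_vec n. P *\<^sub>v v \<in> V \<and> (\<forall>w\<in>V. scalar_prod (v - P *\<^sub>v v) w = 0)))"

text \<open>The residual projection \<open>I\<^sub>n - P\<^sub>S\<close>.  No full-rank assumption on \<open>X\<^sub>S\<close> is made.\<close>

definition resid_proj :: "real mat \<Rightarrow> nat set \<Rightarrow> real mat" where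
  "resid_proj X S =
     1\<^sub>m (dim_row X) - orth_proj (dim_row X) (vec_space.col_space (dim_row X) (col_sub X S))"

definition RSS :: "real mat \<Rightarrow> real Matrix.vec \<Rightarrow> nat set \<Rightarrow> real" where
  "RSS X y S = scalar_prod (resid_proj X S *\<^sub>v y) (resid_proj X S *\<^sub>v y)"

definition DCIC ::
  "real mat \<Rightarrow> (nat \<Rightarrow> nat) \<Rightarrow> real \<Rightarrow> real \<Rightarrow> real \<Rightarrow> real Matrix.vec \<Rightarrow> nat set \<Rightarrow> real" where
  "DCIC X r \<sigma> \<eta> l y S =
     RSS X y S / \<sigma>\<^sup>2 + \<eta> * real (card S) + l * (\<Sum>i\<in>S. code_len r i)"

definition false_pos :: "nat set \<Rightarrow> nat set \<Rightarrow> real" where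
  "false_pos S0 S = real (card (S - S0))"

definition false_neg :: "nat set \<Rightarrow> nat set \<Rightarrow> real" where
  "false_neg S0 S = real (card (S0 - S))"

text \<open>
  If \<open>S0 = {..<p}\<close> the minimum below is over the empty set, and its value is then immaterial: it is
  only ever multiplied by the number of false positives, which is 0 in that case.
\<close>

definition C_min :: "(nat \<Rightarrow> nat) \<Rightarrow> nat \<Rightarrow> nat set \<Rightarrow> real" where
  "C_min r p S0 = (MIN i\<in>{..<p} - S0. code_len r i)"

definition C_max :: "(nat \<Rightarrow> nat) \<Rightarrow> nat set \<Rightarrow> real" where
  "C_max r S0 = (MAX i\<in>S0. code_len r i)"

definition M_sub :: "nat set \<Rightarrow> nat set set" where
  "M_sub S0 = {S. S \<subset> S0}"

definition M_wrong :: "nat \<Rightarrow> nat set \<Rightarrow> nat set set" where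
  "M_wrong p S0 = {S. S \<subseteq> {..<p} \<and> \<not> S \<subseteq> S0 \<and> \<not> S0 \<subseteq> S}"

text \<open>Here \<open>lz\<close> stands for \<open>\<lambda>\<^sub>\<zeta>\<close>, \<open>l\<close> for \<open>\<lambda>\<close>, and \<open>L\<close> is the number of grid points.\<close>

definition L_set ::
  "real \<Rightarrow> nat \<Rightarrow> (nat \<Rightarrow> nat) \<Rightarrow> real \<Rightarrow> nat \<Rightarrow> real \<Rightarrow> nat set \<Rightarrow> real \<Rightarrow> nat set set" where
  "L_set lz p r \<eta> L \<delta> S0 l =
     {S \<in> M_sub S0 \<union> M_wrong p S0.
        (\<eta> + (l - lz) * C_min r p S0) * false_pos S0 S
        - (\<eta> + l * C_max r S0 + lz * ln (real (card S0))) * false_neg S0 S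
        \<le> lz * ln (real L / \<delta>)}"

definition lambda_min :: "real mat \<Rightarrow> real" where
  "lambda_min A = Min (spectrum A)"

text \<open>
  \<open>L_set\<close> always contains the empty set (if \<open>S0\<close> is nonempty, \<open>L \<ge> 1\<close>, \<open>\<delta> < 1\<close> and \<open>l \<ge> lz > 0\<close>), so
  the infimum is over a nonempty finite set; and \<open>S0 - S\<close> is nonempty for each of its members, so
  the matrix, which is symmetric, has at least one eigenvalue.
\<close>

definition omega ::
  "real \<Rightarrow> real mat \<Rightarrow> (nat \<Rightarrow> nat) \<Rightarrow> real \<Rightarrow> nat \<Rightarrow> real \<Rightarrow> nat set \<Rightarrow> real \<Rightarrow> real" where
  "omega lz X r \<eta> L \<delta> S0 l =
     (INF S\<in>L_set lz (dim_col X) r \<eta> L \<delta> S0 l.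
        lambda_min ((1 / real (dim_row X)) \<cdot>\<^sub>m
          (transpose_mat (col_sub X (S0 - S)) * resid_proj X S * col_sub X (S0 - S))))"

definition omega_min ::
  "real \<Rightarrow> real mat \<Rightarrow> (nat \<Rightarrow> nat) \<Rightarrow> real \<Rightarrow> nat \<Rightarrow> real \<Rightarrow> nat set \<Rightarrow> real set \<Rightarrow> real" where
  "omega_min lz X r \<eta> L \<delta> S0 Lam = (MIN l\<in>Lam. omega lz X r \<eta> L \<delta> S0 l)"

definition noise_model :: "real \<Rightarrow> 'w measure \<Rightarrow> nat \<Rightarrow> real \<Rightarrow> (nat \<Rightarrow> 'w \<Rightarrow> real) \<Rightarrow> bool" where
  "noise_model \<zeta> M n \<sigma> e \<longleftrightarrow>
     prob_space M \<and>
     prob_space.indep_vars M (\<lambda>_. borel) e {..<n} \<and>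
     (\<forall>i<n. integrable M (e i) \<and> prob_space.expectation M (e i) = 0 \<and>
        integrable M (\<lambda>w. (e i w)\<^sup>2) \<and> prob_space.expectation M (\<lambda>w. (e i w)\<^sup>2) = \<sigma>\<^sup>2 \<and>
        (\<forall>t\<ge>2. prob_space.prob M {w \<in> space M. \<bar>e i w / \<sigma>\<bar> > t} \<le> 2 * exp (- (t / \<zeta>)\<^sup>2)))"

definition response ::
  "real mat \<Rightarrow> real Matrix.vec \<Rightarrow> (nat \<Rightarrow> 'w \<Rightarrow> real) \<Rightarrow> 'w \<Rightarrow> real Matrix.vec" where
  "response X b e w = X *\<^sub>v b + Matrix.vec (dim_row X) (\<lambda>i. e i w)"

end

theory Submission
  imports Defs
begin

text \<open>
  Compare a minimiser \<open>S\<close> with the true support \<open>S0\<close>.  With \<open>\<mu> = (I - P\<^bsub>S\<^esub>) X \<beta>\<close>, the difference of the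
  residual sums of squares is at least \<open>\<parallel>\<mu>\<parallel>\<^sup>2 / 2\<close> minus twice the squared length of the projection of
  the noise onto an orthonormal system of at most \<open>|S - S0| + 1\<close> vectors: the directions of the span
  of \<open>X\<^bsub>S\<^esub>\<close> beyond that of \<open>X\<^bsub>S \<inter> S0\<^esub>\<close>, and \<open>\<mu> / \<parallel>\<mu>\<parallel>\<close>.  Sub-Gaussian noise gives this projection an
  exponential moment of order \<open>2\<^bsup>|S - S0| + 1\<^esup>\<close>.  Since \<open>exp (- log\<^sup>* r) \<le> 1 / r\<close>, a large multiple of
  the code length of \<open>S - S0\<close> plus \<open>|S0 - S| log |S0|\<close> pays for a union bound over all \<open>S\<close>, which does not
  involve \<open>\<lambda>\<close>.  On the resulting event, comparing the criteria at \<open>S\<close> and \<open>S0\<close> while dropping \<open>\<parallel>\<mu>\<parallel>\<^sup>2\<close>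
  shows \<open>S \<in> \<L>\<^bsub>\<lambda>\<^esub>\<close> unless \<open>S0 \<subseteq> S\<close>; then the restricted eigenvalue bounds \<open>\<parallel>\<mu>\<parallel>\<^sup>2\<close> from below and
  the same comparison gives the claim.
\<close>

section \<open>Sub-Gaussian noise\<close>

text \<open>The linear term of a centred variable disappears under expectation, which leaves an
  exponential moment of the square. On [-1, 1] the bound goes through 1 + x + x^2; outside, cruder
  estimates suffice.\<close>

lemma exp_le_add_exp_square: "exp x \<le> x + exp (x\<^sup>2)" for x :: real
proof -
  have sq: "1 + x\<^sup>2 \<le> exp (x\<^sup>2)" by (rule exp_ge_add_one_self)
  consider "x > 1" | "0 \<le> x" "x \<le> 1" | "-1 \<le> x" "x < 0" | "x < -1" by linarith
  then show ?thesis
  proof cases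
    case 1
    then have "x \<le> x\<^sup>2" by (simp add: power2_eq_square)
    then have "exp x \<le> exp (x\<^sup>2)" by simp
    with 1 show ?thesis by linarith
  next
    case 2
    then show ?thesis using exp_bound[of x] sq by linarith
  next
    case 3
    have "exp x = inverse (exp (- x))" by (simp add: exp_minus)
    also have "\<dots> \<le> inverse (1 - x)"
      using exp_ge_add_one_self[of "- x"] 3 by (intro le_imp_inverse_le) auto
    also have "\<dots> \<le> 1 + x + x\<^sup>2"
    proof -
      have "(1 + x + x\<^sup>2) * (1 - x) = 1 - x ^ 3" by (simp add: algebra_simps power2_eq_square power3_eq_cube)
      moreover have "x ^ 3 \<le> 0" using 3 by (simp add: power_le_zero_eq)
      ultimately have "1 \<le> (1 + x + x\<^sup>2) * (1 - x)" by linarith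
      then show ?thesis using 3 by (simp add: field_simps)
    qed
    finally show ?thesis using sq by linarith
  next
    case 4
    then have "exp x \<le> 1" by simp
    moreover have "- x \<le> x\<^sup>2" using 4 by (sos)
    ultimately show ?thesis using sq by linarith
  qed
qed

text \<open>Cut the range of \<open>\<bar>Z\<bar>\<close> into unit slabs. The part up to 2, below
  the reach of the tail bound, contributes at most \<open>exp (4 * a)\<close>. The slab from k + 2
  to k + 3 contributes at most \<open>2 * exp (- a) ^ k\<close>, because (k + 3)^2 \<le> 4 (k + 2)^2
  - k; the 4 here is the 4 in the rate \<open>a\<close>.\<close>

lemma (in prob_space) exp_square_moment:
  fixes Z :: "'a \<Rightarrow> real"
  assumes [measurable]: "Z \<in> borel_measurable M" and "\<zeta> > 0"
    and tail: "\<And>t. t \<ge> 2 \<Longrightarrow> prob {w \<in> space M. \<bar>Z w\<bar> > t} \<le> 2 * exp (- (t / \<zeta>)\<^sup>2)"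
  shows "(\<integral>\<^sup>+w. exp ((Z w)\<^sup>2 / (4 * \<zeta>\<^sup>2)) \<partial>M)
           \<le> ennreal (exp (1 / \<zeta>\<^sup>2) + 2 / (1 - exp (- 1 / (4 * \<zeta>\<^sup>2))))"
proof -
  define a where "a = 1 / (4 * \<zeta>\<^sup>2)"
  have a: "a > 0" using \<open>\<zeta> > 0\<close> by (simp add: a_def)
  define f where "f k w = exp (a * (real k + 3)\<^sup>2) * indicator {w \<in> space M. \<bar>Z w\<bar> > real k + 2} w" for k w
  have f0: "f k w \<ge> 0" for k w by (simp add: f_def)
  have pt: "ennreal (exp (a * (Z w)\<^sup>2)) \<le> ennreal (exp (4 * a)) + (\<Sum>k. ennreal (f k w))"
    if w: "w \<in> space M" for w
  proof (cases "\<bar>Z w\<bar> \<le> 2")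
    case True
    then have "(Z w)\<^sup>2 \<le> 2\<^sup>2" by (metis abs_ge_zero power2_abs power_mono)
    then have "exp (a * (Z w)\<^sup>2) \<le> exp (4 * a)" using a by simp
    then have "ennreal (exp (a * (Z w)\<^sup>2)) \<le> ennreal (exp (4 * a))" by (simp add: ennreal_leI)
    then show ?thesis by (metis add.right_neutral add_left_mono order_trans zero_le)
  next
    case False
    \<comment> \<open>The ceiling makes the slab open at k + 2 and closed at k + 3, to match the
      strict inequality of the tail event.\<close>
    define k where "k = nat (\<lceil>\<bar>Z w\<bar>\<rceil> - 3)"
    have k: "real k + 2 < \<bar>Z w\<bar>" "\<bar>Z w\<bar> \<le> real k + 3"
      using False unfolding k_def by linarith+
    have "(Z w)\<^sup>2 \<le> (real k + 3)\<^sup>2" using k(2) by (metis abs_ge_zero power2_abs power_mono)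
    then have "exp (a * (Z w)\<^sup>2) \<le> f k w" using a k(1) w by (simp add: f_def)
    then have "ennreal (exp (a * (Z w)\<^sup>2)) \<le> ennreal (f k w)" by (simp add: ennreal_leI)
    also have "\<dots> \<le> (\<Sum>k. ennreal (f k w))"
      using sum_le_suminf[of "\<lambda>k. ennreal (f k w)" "{k}"] by simp
    finally show ?thesis by (metis add_increasing zero_le)
  qed
  have fk: "(\<integral>\<^sup>+w. ennreal (f k w) \<partial>M) \<le> ennreal (2 * exp (- a) ^ k)" for k
  proof -
    have "(\<integral>\<^sup>+w. ennreal (f k w) \<partial>M)
        = (\<integral>\<^sup>+w. ennreal (exp (a * (real k + 3)\<^sup>2)) * indicator {w \<in> space M. \<bar>Z w\<bar> > real k + 2} w \<partial>M)"
      by (intro nn_integral_cong) (simp add: f_def indicator_def)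
    also have "\<dots> = ennreal (exp (a * (real k + 3)\<^sup>2)) * emeasure M {w \<in> space M. \<bar>Z w\<bar> > real k + 2}"
      by (rule nn_integral_cmult_indicator) measurable
    also have "\<dots> = ennreal (exp (a * (real k + 3)\<^sup>2) * prob {w \<in> space M. \<bar>Z w\<bar> > real k + 2})"
      by (simp add: emeasure_eq_measure ennreal_mult)
    also have "\<dots> \<le> ennreal (exp (a * (real k + 3)\<^sup>2) * (2 * exp (- ((real k + 2) / \<zeta>)\<^sup>2)))"
      by (intro ennreal_leI mult_left_mono tail) auto
    also have "exp (a * (real k + 3)\<^sup>2) * (2 * exp (- ((real k + 2) / \<zeta>)\<^sup>2))
        = 2 * exp (a * ((real k + 3)\<^sup>2 - 4 * (real k + 2)\<^sup>2))"
      using \<open>\<zeta> > 0\<close> by (simp add: exp_add[symmetric] a_def field_simps)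
    also have "\<dots> \<le> 2 * exp (- a * real k)"
    proof -
      have "(real k + 3)\<^sup>2 - 4 * (real k + 2)\<^sup>2 = - real k - (7 + 9 * real k + 3 * (real k)\<^sup>2)"
        by (simp add: power2_eq_square algebra_simps)
      then have "(real k + 3)\<^sup>2 - 4 * (real k + 2)\<^sup>2 \<le> - real k"
        by (smt (verit) of_nat_0_le_iff zero_le_power2)
      then have "a * ((real k + 3)\<^sup>2 - 4 * (real k + 2)\<^sup>2) \<le> a * (- real k)"
        using a by (intro mult_left_mono) auto
      then show ?thesis by simp
    qed
    also have "exp (- a * real k) = exp (- a) ^ k" by (metis exp_of_nat2_mult)
    finally show ?thesis by (simp add: ennreal_leI)
  qed
  have "(\<integral>\<^sup>+w. exp (a * (Z w)\<^sup>2) \<partial>M) \<le> (\<integral>\<^sup>+w. (ennreal (exp (4 * a)) + (\<Sum>k. ennreal (f k w))) \<partial>M)"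
    by (intro nn_integral_mono pt)
  also have "\<dots> = (\<integral>\<^sup>+w. ennreal (exp (4 * a)) \<partial>M) + (\<integral>\<^sup>+w. (\<Sum>k. ennreal (f k w)) \<partial>M)"
    unfolding f_def by (intro nn_integral_add) measurable
  also have "(\<integral>\<^sup>+w. (\<Sum>k. ennreal (f k w)) \<partial>M) = (\<Sum>k. \<integral>\<^sup>+w. ennreal (f k w) \<partial>M)"
    unfolding f_def by (intro nn_integral_suminf) measurable
  also have "\<dots> \<le> (\<Sum>k. ennreal (2 * exp (- a) ^ k))"
    by (intro suminf_le fk) auto
  also have "\<dots> = ennreal (2 / (1 - exp (- a)))"
  proof -
    have "(\<lambda>k. 2 * exp (- a) ^ k) sums (2 * (1 / (1 - exp (- a))))"
      using a by (intro sums_mult geometric_sums) auto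
    then show ?thesis by (intro suminf_ennreal_eq) auto
  qed
  finally have *: "(\<integral>\<^sup>+w. exp (a * (Z w)\<^sup>2) \<partial>M) \<le> ennreal (exp (4 * a)) + ennreal (2 / (1 - exp (- a)))"
    by (simp add: emeasure_space_1)
  have "2 / (1 - exp (- a)) \<ge> 0" using a by simp
  then have "ennreal (exp (4 * a)) + ennreal (2 / (1 - exp (- a))) = ennreal (exp (4 * a) + 2 / (1 - exp (- a)))"
    by simp
  with * show ?thesis by (simp add: a_def)
qed

text \<open>For small s, \<open>exp_le_add_exp_square\<close> removes the mean, and convexity of exp
  between 0 and \<open>a * (Z w)\<^sup>2\<close> yields 1 + \<theta> B with \<theta> = s^2 / a. For
  large s, Young's inequality suffices: the prefactor B is absorbed into the exponent since s^2 / a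
  > 1.\<close>

lemma (in prob_space) subgaussian_mgf:
  fixes Z :: "'a \<Rightarrow> real"
  assumes meas[measurable]: "Z \<in> borel_measurable M" and Zint: "integrable M Z" and Z0: "expectation Z = 0"
    and a: "a > 0" and B: "(\<integral>\<^sup>+w. exp (a * (Z w)\<^sup>2) \<partial>M) \<le> ennreal B"
  shows "(\<integral>\<^sup>+w. exp (s * Z w) \<partial>M) \<le> ennreal (exp ((B / a + 1 / a) * s\<^sup>2))"
proof -
  have "1 \<le> (\<integral>\<^sup>+w. ennreal (exp (a * (Z w)\<^sup>2)) \<partial>M)"
  proof -
    have "(\<integral>\<^sup>+w. 1 \<partial>M) \<le> (\<integral>\<^sup>+w. ennreal (exp (a * (Z w)\<^sup>2)) \<partial>M)"
      using a by (intro nn_integral_mono) (simp add: ennreal_leI flip: ennreal_1)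
    then show ?thesis by (simp add: emeasure_space_1)
  qed
  then have "ennreal 1 \<le> ennreal B" using B by (simp flip: ennreal_1)
  then have B1: "B \<ge> 1" using ennreal_le_iff2 by fastforce
  have fin: "(\<integral>\<^sup>+w. ennreal (exp (a * (Z w)\<^sup>2)) \<partial>M) < \<infinity>"
    using B by (simp add: le_less_trans)
  have int: "integrable M (\<lambda>w. exp (a * (Z w)\<^sup>2))"
    by (intro integrableI_bounded) (use fin in auto)
  have EB: "expectation (\<lambda>w. exp (a * (Z w)\<^sup>2)) \<le> B"
    using B B1 nn_integral_eq_integral[OF int] by (simp add: ennreal_le_iff)
  show ?thesis
  proof (cases "s\<^sup>2 \<le> a")
    case True
    define \<theta> where "\<theta> = s\<^sup>2 / a"
    have \<theta>: "0 \<le> \<theta>" "\<theta> \<le> 1" using True a by (auto simp: \<theta>_def)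
    have pt: "exp (s * Z w) \<le> s * Z w + (1 - \<theta> + \<theta> * exp (a * (Z w)\<^sup>2))" for w
    proof -
      have "exp (s * Z w) \<le> s * Z w + exp ((s * Z w)\<^sup>2)" by (rule exp_le_add_exp_square)
      also have "(s * Z w)\<^sup>2 = \<theta> * (a * (Z w)\<^sup>2)" using a by (simp add: \<theta>_def power_mult_distrib)
      also have "exp (\<theta> * (a * (Z w)\<^sup>2)) \<le> (1 - \<theta>) * exp 0 + \<theta> * exp (a * (Z w)\<^sup>2)"
        using convex_onD[OF exp_convex, of \<theta> 0 "a * (Z w)\<^sup>2"] \<theta> by simp
      finally show ?thesis by simp
    qed
    have "(\<integral>\<^sup>+w. exp (s * Z w) \<partial>M) \<le> (\<integral>\<^sup>+w. ennreal (s * Z w + (1 - \<theta> + \<theta> * exp (a * (Z w)\<^sup>2))) \<partial>M)"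
      by (intro nn_integral_mono ennreal_leI pt)
    also have "\<dots> = ennreal (expectation (\<lambda>w. s * Z w + (1 - \<theta> + \<theta> * exp (a * (Z w)\<^sup>2))))"
      by (intro nn_integral_eq_integral Bochner_Integration.integrable_add integrable_mult_right Zint int AE_I2)
         (auto intro: order_trans[OF _ pt])
    also have "expectation (\<lambda>w. s * Z w + (1 - \<theta> + \<theta> * exp (a * (Z w)\<^sup>2))) = 1 - \<theta> + \<theta> * expectation (\<lambda>w. exp (a * (Z w)\<^sup>2))"
      using Zint int Z0 by (simp add: prob_space)
    also have "\<dots> \<le> 1 + \<theta> * B" using EB \<theta>(1) by (simp add: mult_left_mono add_mono)
    also have "\<dots> \<le> exp (\<theta> * B)" by (rule exp_ge_add_one_self)
    also have "\<dots> \<le> exp ((B / a + 1 / a) * s\<^sup>2)" using a by (simp add: \<theta>_def field_simps)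
    finally show ?thesis by (simp add: ennreal_leI)
  next
    case False
    have pt: "exp (s * Z w) \<le> exp (s\<^sup>2 / a) * exp (a * (Z w)\<^sup>2)" for w
    proof -
      have "0 \<le> (s / sqrt a - sqrt a * Z w)\<^sup>2 + (s / sqrt a)\<^sup>2 + (sqrt a * Z w)\<^sup>2" by simp
      also have "\<dots> = 2 * (s\<^sup>2 / a + a * (Z w)\<^sup>2 - s * Z w)"
        using a by (simp add: power2_diff power_mult_distrib power_divide)
      finally show ?thesis by (simp flip: exp_add)
    qed
    have "(\<integral>\<^sup>+w. exp (s * Z w) \<partial>M) \<le> (\<integral>\<^sup>+w. ennreal (exp (s\<^sup>2 / a)) * ennreal (exp (a * (Z w)\<^sup>2)) \<partial>M)"
      by (intro nn_integral_mono) (simp add: pt ennreal_leI flip: ennreal_mult)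
    also have "\<dots> = ennreal (exp (s\<^sup>2 / a)) * (\<integral>\<^sup>+w. ennreal (exp (a * (Z w)\<^sup>2)) \<partial>M)"
      by (intro nn_integral_cmult) measurable
    also have "\<dots> \<le> ennreal (exp (s\<^sup>2 / a)) * ennreal B" by (intro mult_left_mono B) auto
    also have "\<dots> = ennreal (exp (s\<^sup>2 / a) * B)" using B1 by (simp add: ennreal_mult)
    also have "exp (s\<^sup>2 / a) * B \<le> exp (s\<^sup>2 / a) * exp (B * (s\<^sup>2 / a))"
    proof -
      have "B * 1 \<le> B * (s\<^sup>2 / a)" using False a B1 by (intro mult_left_mono) auto
      also have "B * (s\<^sup>2 / a) \<le> exp (B * (s\<^sup>2 / a))"
        using exp_ge_add_one_self[of "B * (s\<^sup>2 / a)"] by linarith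
      finally show ?thesis by simp
    qed
    also have "\<dots> = exp ((B / a + 1 / a) * s\<^sup>2)" by (simp flip: exp_add add: field_simps)
    finally show ?thesis by (simp add: ennreal_leI)
  qed
qed

section \<open>Inner products and squared projections in coordinates\<close>

text \<open>Vectors of length \<open>n\<close> are functions on the naturals of which only the values below \<open>n\<close> matter.\<close>

definition ip :: "nat \<Rightarrow> (nat \<Rightarrow> real) \<Rightarrow> (nat \<Rightarrow> real) \<Rightarrow> real" where
  "ip n u v = (\<Sum>i<n. u i * v i)"

lemma ip_commute: "ip n u v = ip n v u"
  by (simp add: ip_def mult.commute)

lemma ip_add_left: "ip n (\<lambda>i. u i + v i) w = ip n u w + ip n v w"
  by (simp add: ip_def algebra_simps sum.distrib)

lemma ip_diff_left: "ip n (\<lambda>i. u i - v i) w = ip n u w - ip n v w"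
  by (simp add: ip_def algebra_simps sum_subtractf)

lemma ip_scale_left: "ip n (\<lambda>i. c * v i) w = c * ip n v w"
  by (simp add: ip_def sum_distrib_left mult.assoc)

lemma ip_add_right: "ip n w (\<lambda>i. u i + v i) = ip n w u + ip n w v"
  by (simp add: ip_def algebra_simps sum.distrib)

lemma ip_diff_right: "ip n w (\<lambda>i. u i - v i) = ip n w u - ip n w v"
  by (simp add: ip_def algebra_simps sum_subtractf)

lemma ip_scale_right: "ip n w (\<lambda>i. c * v i) = c * ip n w v"
  by (simp add: ip_def sum_distrib_left mult.left_commute)

lemma ip_self_nonneg: "ip n v v \<ge> 0"
  by (simp add: ip_def sum_nonneg)

lemma ip_self_eq_0: "ip n v v = 0 \<longleftrightarrow> (\<forall>i<n. v i = 0)"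
  by (simp add: ip_def sum_nonneg_eq_0_iff) auto

lemma ip_cong: "(\<And>i. i < n \<Longrightarrow> u i = u' i) \<Longrightarrow> (\<And>i. i < n \<Longrightarrow> v i = v' i) \<Longrightarrow> ip n u v = ip n u' v'"
  by (simp add: ip_def)

fun orthonormal :: "nat \<Rightarrow> (nat \<Rightarrow> real) list \<Rightarrow> bool" where
  "orthonormal n [] = True"
| "orthonormal n (q # qs) = (ip n q q = 1 \<and> (\<forall>q'\<in>set qs. ip n q q' = 0) \<and> orthonormal n qs)"

definition proj_sq :: "nat \<Rightarrow> (nat \<Rightarrow> real) list \<Rightarrow> (nat \<Rightarrow> real) \<Rightarrow> real" where
  "proj_sq n qs v = (\<Sum>q\<leftarrow>qs. (ip n q v)\<^sup>2)"

lemma proj_sq_Nil [simp]: "proj_sq n [] v = 0"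
  and proj_sq_Cons [simp]: "proj_sq n (q # qs) v = (ip n q v)\<^sup>2 + proj_sq n qs v"
  and proj_sq_append [simp]: "proj_sq n (qs @ rs) v = proj_sq n qs v + proj_sq n rs v"
  by (simp_all add: proj_sq_def)

lemma proj_sq_nonneg: "proj_sq n qs v \<ge> 0"
  by (induction qs) auto

lemma borel_measurable_ip [measurable (raw)]:
  "(\<And>i. i < n \<Longrightarrow> (\<lambda>w. v i w) \<in> borel_measurable M) \<Longrightarrow> (\<lambda>w. ip n q (\<lambda>i. v i w)) \<in> borel_measurable M"
  unfolding ip_def by (intro borel_measurable_sum borel_measurable_times) auto

lemma borel_measurable_proj_sq [measurable (raw)]:
  "(\<And>i. i < n \<Longrightarrow> (\<lambda>w. v i w) \<in> borel_measurable M) \<Longrightarrow> (\<lambda>w. proj_sq n qs (\<lambda>i. v i w)) \<in> borel_measurable M"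
  by (induction qs) (auto intro!: borel_measurable_add borel_measurable_power borel_measurable_ip)

section \<open>Gaussian linearisation of squared projections\<close>

lemma nn_integral_exp_std_normal:
  "(\<integral>\<^sup>+g. ennreal (exp (t * g)) * ennreal (std_normal_density g) \<partial>lborel) = ennreal (exp (t\<^sup>2 / 2))"
proof -
  have "exp (t * g) * std_normal_density g = exp (t\<^sup>2 / 2) * normal_density t 1 g" for g
    by (simp add: normal_density_def field_simps power2_diff flip: exp_add)
  then have "(\<integral>\<^sup>+g. ennreal (exp (t * g)) * ennreal (std_normal_density g) \<partial>lborel)
      = (\<integral>\<^sup>+g. ennreal (exp (t\<^sup>2 / 2)) * ennreal (normal_density t 1 g) \<partial>lborel)"
    by (intro nn_integral_cong) (simp flip: ennreal_mult add: normal_density_nonneg)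
  also have "\<dots> = ennreal (exp (t\<^sup>2 / 2)) * (\<integral>\<^sup>+g. ennreal (normal_density t 1 g) \<partial>lborel)"
    by (intro nn_integral_cmult) measurable
  also have "(\<integral>\<^sup>+g. ennreal (normal_density t 1 g) \<partial>lborel) = 1"
    using prob_space.emeasure_space_1[OF prob_space_normal_density[of 1 t]]
    by (simp add: emeasure_density)
  finally show ?thesis by simp
qed

text \<open>The factor halves the exponent of the density, which becomes \<open>sqrt 2\<close> times
  the centred normal density of variance 2.\<close>

lemma nn_integral_exp_square_std_normal:
  "(\<integral>\<^sup>+g. ennreal (exp (g\<^sup>2 / 4)) * ennreal (std_normal_density g) \<partial>lborel) = ennreal (sqrt 2)"
proof -
  have eq: "exp (g\<^sup>2 / 4) * std_normal_density g = sqrt 2 * normal_density 0 (sqrt 2) g" for g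
    by (simp add: normal_density_def field_simps real_sqrt_mult flip: exp_add)
  then have "(\<integral>\<^sup>+g. ennreal (exp (g\<^sup>2 / 4)) * ennreal (std_normal_density g) \<partial>lborel)
      = (\<integral>\<^sup>+g. ennreal (sqrt 2) * ennreal (normal_density 0 (sqrt 2) g) \<partial>lborel)"
    by (intro nn_integral_cong) (simp flip: ennreal_mult add: normal_density_nonneg)
  also have "\<dots> = ennreal (sqrt 2) * (\<integral>\<^sup>+g. ennreal (normal_density 0 (sqrt 2) g) \<partial>lborel)"
    by (intro nn_integral_cmult) measurable
  also have "(\<integral>\<^sup>+g. ennreal (normal_density 0 (sqrt 2) g) \<partial>lborel) = 1"
    using prob_space.emeasure_space_1[OF prob_space_normal_density[of "sqrt 2" 0]]
    by (simp add: emeasure_density)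
  finally show ?thesis by simp
qed

text \<open>
  A Gaussian variable \<open>g\<close> linearises each square through
  \<open>exp (c x\<^sup>2) = \<integral> exp (\<surd>(2 c) g x) d\<gamma>(g)\<close>, and \<open>v\<close> collects the linear terms produced so far;
  orthogonality of \<open>v\<close> to the remaining vectors makes the squared norms add up.
\<close>

lemma (in prob_space) exp_proj_sq_moment_aux:
  assumes Z[measurable]: "\<And>i. i < n \<Longrightarrow> Z i \<in> borel_measurable M"
    and \<kappa>: "\<kappa> > 0"
    and mgf: "\<And>v. (\<integral>\<^sup>+w. exp (ip n v (\<lambda>i. Z i w)) \<partial>M) \<le> ennreal (exp (\<kappa> * ip n v v))"
  shows "orthonormal n qs \<Longrightarrow> (\<forall>q\<in>set qs. ip n q v = 0) \<Longrightarrow>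
     (\<integral>\<^sup>+w. ennreal (exp (ip n v (\<lambda>i. Z i w) + proj_sq n qs (\<lambda>i. Z i w) / (8 * \<kappa>))) \<partial>M)
       \<le> ennreal (sqrt 2 ^ length qs * exp (\<kappa> * ip n v v))"
proof (induction qs arbitrary: v)
  case Nil
  then show ?case using mgf by simp
next
  case (Cons q qs)
  \<comment> \<open>With c = 1 / (8 \<kappa>) the linearising coefficient is sqrt (2 c). It
    satisfies \<kappa> h^2 = 1/4, so that the moment bound leaves
    \<open>exp (g\<^sup>2 / 4)\<close>, which is integrable against the Gaussian and costs
    \<open>sqrt 2\<close> per vector.\<close>
  define h where "h = sqrt (1 / (4 * \<kappa>))"
  have h2: "h\<^sup>2 = 1 / (4 * \<kappa>)" using \<kappa> by (simp add: h_def)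
  interpret N: sigma_finite_measure "lborel :: real measure" by (rule lborel.sigma_finite_measure_axioms)
  interpret P: pair_sigma_finite M "lborel :: real measure" ..
  have Zip[measurable]: "(\<lambda>w. ip n u (\<lambda>i. Z i w)) \<in> borel_measurable M" for u by measurable
  have Zps[measurable]: "(\<lambda>w. proj_sq n qs (\<lambda>i. Z i w)) \<in> borel_measurable M" by measurable
  define F where "F w g = ennreal (exp (ip n v (\<lambda>i. Z i w) + proj_sq n qs (\<lambda>i. Z i w) / (8 * \<kappa>) + h * ip n q (\<lambda>i. Z i w) * g))
     * ennreal (std_normal_density g)" for w g
  have [measurable]: "(\<lambda>(w,g). F w g) \<in> borel_measurable (M \<Otimes>\<^sub>M lborel)"
    unfolding F_def by measurable
  have "ennreal (exp (ip n v (\<lambda>i. Z i w) + proj_sq n (q # qs) (\<lambda>i. Z i w) / (8 * \<kappa>))) = (\<integral>\<^sup>+g. F w g \<partial>lborel)" for w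
  proof -
    have "(\<integral>\<^sup>+g. F w g \<partial>lborel) = (\<integral>\<^sup>+g. ennreal (exp (ip n v (\<lambda>i. Z i w) + proj_sq n qs (\<lambda>i. Z i w) / (8 * \<kappa>))) *
        (ennreal (exp (h * ip n q (\<lambda>i. Z i w) * g)) * ennreal (std_normal_density g)) \<partial>lborel)"
      by (intro nn_integral_cong) (simp add: F_def exp_add ennreal_mult mult.assoc)
    also have "\<dots> = ennreal (exp (ip n v (\<lambda>i. Z i w) + proj_sq n qs (\<lambda>i. Z i w) / (8 * \<kappa>))) * ennreal (exp ((h * ip n q (\<lambda>i. Z i w))\<^sup>2 / 2))"
      by (subst nn_integral_cmult) (auto simp: nn_integral_exp_std_normal)
    also have "\<dots> = ennreal (exp (ip n v (\<lambda>i. Z i w) + proj_sq n (q # qs) (\<lambda>i. Z i w) / (8 * \<kappa>)))"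
      by (simp add: power_mult_distrib h2 add_divide_distrib ac_simps flip: ennreal_mult exp_add)
    finally show ?thesis ..
  qed
  then have "(\<integral>\<^sup>+w. ennreal (exp (ip n v (\<lambda>i. Z i w) + proj_sq n (q # qs) (\<lambda>i. Z i w) / (8 * \<kappa>))) \<partial>M)
      = (\<integral>\<^sup>+w. \<integral>\<^sup>+g. F w g \<partial>lborel \<partial>M)" by simp
  also have "\<dots> = (\<integral>\<^sup>+g. \<integral>\<^sup>+w. F w g \<partial>M \<partial>lborel)" by (rule P.Fubini'[symmetric]) measurable
  also have "\<dots> \<le> (\<integral>\<^sup>+g. ennreal (sqrt 2 ^ length qs * exp (\<kappa> * ip n v v)) * (ennreal (exp (g\<^sup>2 / 4)) * ennreal (std_normal_density g)) \<partial>lborel)"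
  proof (rule nn_integral_mono)
    fix g
    \<comment> \<open>For fixed g the new linear term joins \<open>v\<close>. As \<open>q\<close> is
      a unit vector orthogonal to \<open>v\<close>, the squared norm grows by exactly
      \<open>(h * g)\<^sup>2\<close>.\<close>
    define v' where "v' = (\<lambda>i. v i + (h * g) * q i)"
    have "ip n q' q = 0" if "q' \<in> set qs" for q'
      using Cons.prems that by (simp add: ip_commute[of n q' q])
    then have orth: "\<forall>q'\<in>set qs. ip n q' v' = 0"
      using Cons.prems by (simp add: v'_def ip_add_right ip_scale_right)
    have nv: "ip n v' v' = ip n v v + (h * g)\<^sup>2"
      using Cons.prems by (simp add: v'_def ip_add_right ip_add_left ip_scale_right ip_scale_left power2_eq_square ip_commute[of n v q])
    have "(\<integral>\<^sup>+w. F w g \<partial>M) = (\<integral>\<^sup>+w. ennreal (exp (ip n v' (\<lambda>i. Z i w) + proj_sq n qs (\<lambda>i. Z i w) / (8 * \<kappa>))) \<partial>M) * ennreal (std_normal_density g)"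
      unfolding F_def by (subst nn_integral_multc) (simp_all add: v'_def ip_add_left ip_scale_left algebra_simps)
    also have "\<dots> \<le> ennreal (sqrt 2 ^ length qs * exp (\<kappa> * ip n v' v')) * ennreal (std_normal_density g)"
      using Cons.prems orth by (intro mult_right_mono Cons.IH) auto
    also have "sqrt 2 ^ length qs * exp (\<kappa> * ip n v' v') = (sqrt 2 ^ length qs * exp (\<kappa> * ip n v v)) * exp (g\<^sup>2 / 4)"
      using \<kappa> by (simp add: nv power_mult_distrib h2 field_simps flip: exp_add)
    finally show "(\<integral>\<^sup>+w. F w g \<partial>M) \<le> ennreal (sqrt 2 ^ length qs * exp (\<kappa> * ip n v v)) * (ennreal (exp (g\<^sup>2 / 4)) * ennreal (std_normal_density g))"
      by (simp add: ennreal_mult mult.assoc)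
  qed
  also have "\<dots> = ennreal (sqrt 2 ^ length qs * exp (\<kappa> * ip n v v)) * ennreal (sqrt 2)"
    by (subst nn_integral_cmult) (auto simp: nn_integral_exp_square_std_normal)
  also have "\<dots> = ennreal (sqrt 2 ^ length (q # qs) * exp (\<kappa> * ip n v v))"
    by (simp add: ac_simps flip: ennreal_mult)
  finally show ?case .
qed

text \<open>Chernoff's bound: Markov's inequality for the exponential moment of
  \<open>exp_proj_sq_moment_aux\<close> at \<open>v\<close> = 0. The base \<open>sqrt 2\<close> is
  coarsened to 2.\<close>

lemma (in prob_space) proj_sq_tail:
  assumes Z[measurable]: "\<And>i. i < n \<Longrightarrow> Z i \<in> borel_measurable M"
    and \<kappa>: "\<kappa> > 0"
    and mgf: "\<And>v. (\<integral>\<^sup>+w. exp (ip n v (\<lambda>i. Z i w)) \<partial>M) \<le> ennreal (exp (\<kappa> * ip n v v))"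
    and on: "orthonormal n qs"
  shows "prob {w \<in> space M. proj_sq n qs (\<lambda>i. Z i w) > 8 * \<kappa> * x} \<le> 2 ^ length qs * exp (- x)"
proof -
  have [measurable]: "(\<lambda>w. proj_sq n qs (\<lambda>i. Z i w)) \<in> borel_measurable M" by measurable
  let ?A = "{w \<in> space M. proj_sq n qs (\<lambda>i. Z i w) > 8 * \<kappa> * x}"
  have "ennreal (exp x) * emeasure M ?A = (\<integral>\<^sup>+w. ennreal (exp x) * indicator ?A w \<partial>M)"
    by (rule nn_integral_cmult_indicator[symmetric]) measurable
  also have "\<dots> \<le> (\<integral>\<^sup>+w. ennreal (exp (ip n (\<lambda>_. 0) (\<lambda>i. Z i w) + proj_sq n qs (\<lambda>i. Z i w) / (8 * \<kappa>))) \<partial>M)"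
    using \<kappa> by (intro nn_integral_mono) (auto simp: indicator_def ip_def field_simps intro!: ennreal_leI)
  also have "\<dots> \<le> ennreal (sqrt 2 ^ length qs * exp (\<kappa> * ip n (\<lambda>_. 0) (\<lambda>_. 0)))"
    using on by (intro exp_proj_sq_moment_aux[OF Z \<kappa> mgf]) (auto simp: ip_def)
  also have "\<dots> \<le> ennreal (2 ^ length qs)"
    by (intro ennreal_leI) (auto simp: ip_def intro!: power_mono real_le_lsqrt)
  finally have "ennreal (exp x * prob ?A) \<le> ennreal (2 ^ length qs)"
    by (simp add: emeasure_eq_measure ennreal_mult)
  then have "exp x * prob ?A \<le> 2 ^ length qs" by (simp add: ennreal_le_iff)
  then show ?thesis by (simp add: exp_minus field_simps)
qed

lemma (in prob_space) indep_ip_mgf: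
  assumes indep: "indep_vars (\<lambda>_. borel) Z {..<n}"
    and mgf: "\<And>i s. i < n \<Longrightarrow> (\<integral>\<^sup>+w. exp (s * Z i w) \<partial>M) \<le> ennreal (exp (\<kappa> * s\<^sup>2))"
  shows "(\<integral>\<^sup>+w. exp (ip n v (\<lambda>i. Z i w)) \<partial>M) \<le> ennreal (exp (\<kappa> * ip n v v))"
proof -
  have "(\<integral>\<^sup>+w. exp (ip n v (\<lambda>i. Z i w)) \<partial>M) = (\<integral>\<^sup>+w. (\<Prod>i<n. ennreal (exp (v i * Z i w))) \<partial>M)"
    by (simp add: ip_def exp_sum prod_ennreal)
  also have "\<dots> = (\<Prod>i<n. \<integral>\<^sup>+w. ennreal (exp (v i * Z i w)) \<partial>M)"
    by (intro indep_vars_nn_integral indep_vars_compose2[OF indep]) auto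
  also have "\<dots> \<le> (\<Prod>i<n. ennreal (exp (\<kappa> * (v i)\<^sup>2)))"
    by (intro prod_mono_ennreal mgf) auto
  also have "\<dots> = ennreal (exp (\<kappa> * ip n v v))"
    by (simp add: ip_def prod_ennreal exp_sum sum_distrib_left power2_eq_square)
  finally show ?thesis .
qed

section \<open>Rayleigh's principle for the least eigenvalue\<close>

definition mat_apply :: "nat \<Rightarrow> (nat \<Rightarrow> nat \<Rightarrow> real) \<Rightarrow> (nat \<Rightarrow> real) \<Rightarrow> nat \<Rightarrow> real" where
  "mat_apply m A x = (\<lambda>i. ip m (A i) x)"

lemma mat_apply_add: "mat_apply m A (\<lambda>i. x i + y i) = (\<lambda>i. mat_apply m A x i + mat_apply m A y i)"
  and mat_apply_scale: "mat_apply m A (\<lambda>i. c * x i) = (\<lambda>i. c * mat_apply m A x i)"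
  by (simp_all add: mat_apply_def ip_add_right ip_scale_right)

lemma ip_mat_apply_symmetric:
  assumes "\<And>i j. i < m \<Longrightarrow> j < m \<Longrightarrow> A i j = A j i"
  shows "ip m x (mat_apply m A y) = ip m (mat_apply m A x) y"
proof -
  have "ip m x (mat_apply m A y) = (\<Sum>i<m. \<Sum>j<m. x i * A i j * y j)"
    by (simp add: ip_def mat_apply_def sum_distrib_left mult.assoc)
  also have "\<dots> = (\<Sum>j<m. \<Sum>i<m. x i * A i j * y j)" by (rule sum.swap)
  also have "\<dots> = (\<Sum>j<m. \<Sum>i<m. A j i * x i * y j)"
    using assms by (intro sum.cong) auto
  also have "\<dots> = ip m (mat_apply m A x) y"
    by (simp add: ip_def mat_apply_def sum_distrib_right)
  finally show ?thesis .
qed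

lemma mat_apply_bounded:
  obtains K where "K > 0" "\<And>x. ip m (mat_apply m A x) (mat_apply m A x) \<le> K * ip m x x"
proof
  let ?K = "(\<Sum>i<m. ip m (A i) (A i))"
  \<comment> \<open>The added 1 keeps the constant positive when all rows vanish; the bound itself
    is Cauchy-Schwarz applied to each row.\<close>
  show "?K + 1 > 0" by (simp add: add_nonneg_pos sum_nonneg ip_self_nonneg)
  show "ip m (mat_apply m A x) (mat_apply m A x) \<le> (?K + 1) * ip m x x" for x
  proof -
    have "(ip m (A i) x)\<^sup>2 \<le> ip m (A i) (A i) * ip m x x" for i
      using Cauchy_Schwarz_ineq_sum[of "A i" x "{..<m}"] by (simp add: ip_def power2_eq_square)
    then have "(\<Sum>i<m. (ip m (A i) x)\<^sup>2) \<le> (\<Sum>i<m. ip m (A i) (A i) * ip m x x)"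
      by (intro sum_mono)
    also have "\<dots> = ?K * ip m x x" by (simp add: sum_distrib_right)
    also have "\<dots> \<le> (?K + 1) * ip m x x" by (simp add: algebra_simps ip_self_nonneg)
    finally show ?thesis
      unfolding mat_apply_def ip_def[of m "\<lambda>i. ip m (A i) x"] power2_eq_square .
  qed
qed

lemma quadratic_form_bounded:
  obtains K where "K > 0" "\<And>x. \<bar>ip m x (mat_apply m A x)\<bar> \<le> K * ip m x x"
proof -
  obtain K where K: "K > 0" "\<And>x. ip m (mat_apply m A x) (mat_apply m A x) \<le> K * ip m x x"
    using mat_apply_bounded[of m A] by blast
  have "\<bar>ip m x (mat_apply m A x)\<bar> \<le> (1 + K) * ip m x x" for x
  proof -
    let ?y = "mat_apply m A x"
    have "0 \<le> ip m (\<lambda>i. x i + ?y i) (\<lambda>i. x i + ?y i)" "0 \<le> ip m (\<lambda>i. x i - ?y i) (\<lambda>i. x i - ?y i)"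
      by (rule ip_self_nonneg)+
    then have "2 * \<bar>ip m x ?y\<bar> \<le> ip m x x + ip m ?y ?y"
      by (simp add: ip_add_left ip_add_right ip_diff_left ip_diff_right ip_commute[of m ?y x])
    moreover have "0 \<le> ip m x x" "0 \<le> ip m ?y ?y" by (rule ip_self_nonneg)+
    ultimately show ?thesis using K(2)[of x] by (simp add: algebra_simps)
  qed
  then show thesis using K(1) by (intro that[of "1 + K"]) auto
qed

text \<open>
  If the form of \<open>B\<close> is nonnegative and \<open>B\<close> is injective with a bounded inverse, then the form is
  coercive: insert \<open>x - B x / L\<close> into the form, where \<open>L\<close> bounds the form on unit vectors.
\<close>

lemma psd_coercive:
  assumes sym: "\<And>i j. i < m \<Longrightarrow> j < m \<Longrightarrow> B i j = B j i"
    and psd: "\<And>x. 0 \<le> ip m x (mat_apply m B x)"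
    and inv: "\<And>x i. i < m \<Longrightarrow> mat_apply m C (mat_apply m B x) i = x i"
  obtains \<kappa> where "\<kappa> > 0" "\<And>x. \<kappa> * ip m x x \<le> ip m x (mat_apply m B x)"
proof -
  obtain K where K: "K > 0" "\<And>x. ip m (mat_apply m C x) (mat_apply m C x) \<le> K * ip m x x"
    using mat_apply_bounded[of m C] by blast
  obtain L where L: "L > 0" "\<And>x. \<bar>ip m x (mat_apply m B x)\<bar> \<le> L * ip m x x"
    using quadratic_form_bounded[of m B] by blast
  have "1 / (L * K) * ip m x x \<le> ip m x (mat_apply m B x)" for x
  proof -
    let ?y = "mat_apply m B x"
    let ?t = "- (1 / L)"
    have "ip m x x = ip m (mat_apply m C ?y) (mat_apply m C ?y)"
      by (intro ip_cong) (simp_all add: inv)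
    then have 1: "ip m x x \<le> K * ip m ?y ?y" using K(2) by simp
    have "0 \<le> ip m (\<lambda>i. x i + ?t * ?y i) (mat_apply m B (\<lambda>i. x i + ?t * ?y i))"
      by (rule psd)
    also have "\<dots> = ip m x ?y + ?t * ip m x (mat_apply m B ?y) + ?t * ip m ?y ?y
        + ?t\<^sup>2 * ip m ?y (mat_apply m B ?y)"
      unfolding mat_apply_add mat_apply_scale ip_add_left ip_add_right ip_scale_left ip_scale_right
      by (simp add: algebra_simps power2_eq_square)
    also have "ip m x (mat_apply m B ?y) = ip m ?y ?y"
      using sym by (rule ip_mat_apply_symmetric)
    also have "ip m x ?y + ?t * ip m ?y ?y + ?t * ip m ?y ?y + ?t\<^sup>2 * ip m ?y (mat_apply m B ?y)
        \<le> ip m x ?y + ?t * ip m ?y ?y + ?t * ip m ?y ?y + ?t\<^sup>2 * (L * ip m ?y ?y)"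
      using L(2)[of ?y] by (intro add_left_mono mult_left_mono) auto
    also have "\<dots> = ip m x ?y - ip m ?y ?y / L" using L(1) by (simp add: field_simps power2_eq_square)
    finally have "ip m ?y ?y \<le> L * ip m x ?y" using L(1) by (simp add: field_simps)
    then have "K * ip m ?y ?y \<le> K * (L * ip m x ?y)" using K(1) by simp
    with 1 have "ip m x x \<le> (L * K) * ip m x ?y" by (simp add: ac_simps)
    then show ?thesis using K(1) L(1) by (simp add: pos_divide_le_eq mult.commute)
  qed
  then show thesis using K(1) L(1) by (intro that[of "1 / (L * K)"]) auto
qed

lemma min_spectrum_le_quadratic_form:
  fixes A :: "real mat"
  assumes A: "A \<in> carrier_mat m m"
    and sym: "\<And>i j. i < m \<Longrightarrow> j < m \<Longrightarrow> A $$ (i, j) = A $$ (j, i)"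
    and x: "x \<in> carrier_vec m"
  shows "Min (spectrum A) * scalar_prod x x \<le> scalar_prod x (A *\<^sub>v x)"
proof -
  define A' where "A' i j = A $$ (i, j)" for i j
  define Q where "Q x = ip m x (mat_apply m A' x)" for x
  define m0 where "m0 = (INF x\<in>{x. ip m x x = 1}. Q x)"
  have scale: "Q (\<lambda>i. c * x i) = c\<^sup>2 * Q x" for c x
    by (simp add: Q_def mat_apply_scale ip_scale_left ip_scale_right power2_eq_square)
  obtain K where K: "\<And>x. \<bar>Q x\<bar> \<le> K * ip m x x"
    unfolding Q_def using quadratic_form_bounded[of m A'] by blast
  have bdd: "bdd_below (Q ` {x. ip m x x = 1})"
  proof (rule bdd_belowI2)
    fix x assume "x \<in> {x. ip m x x = 1}"
    with K[of x] show "- K \<le> Q x" by simp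
  qed
  have m0: "m0 * ip m x x \<le> Q x" for x
  proof (cases "ip m x x = 0")
    case True
    then show ?thesis using K[of x] by simp
  next
    case False
    then have pos: "ip m x x > 0" using ip_self_nonneg[of m x] by linarith
    define c where "c = 1 / sqrt (ip m x x)"
    have c2: "c\<^sup>2 = 1 / ip m x x" using pos by (simp add: c_def power_divide)
    have "ip m (\<lambda>i. c * x i) (\<lambda>i. c * x i) = c\<^sup>2 * ip m x x"
      by (simp add: ip_scale_left ip_scale_right power2_eq_square)
    then have "ip m (\<lambda>i. c * x i) (\<lambda>i. c * x i) = 1" using pos by (simp add: c2)
    then have "m0 \<le> Q (\<lambda>i. c * x i)" unfolding m0_def by (intro cINF_lower[OF bdd]) auto
    then show ?thesis using pos by (simp add: scale c2 field_simps)
  qed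
  have ipx: "scalar_prod x x = ip m (\<lambda>i. x $ i) (\<lambda>i. x $ i)"
    using x by (simp add: scalar_prod_def ip_def atLeast0LessThan)
  have Qx: "scalar_prod x (A *\<^sub>v x) = Q (\<lambda>i. x $ i)"
    using x A by (simp add: scalar_prod_def ip_def atLeast0LessThan Q_def mat_apply_def A'_def)
  show ?thesis
  proof (cases "m = 0")
    \<comment> \<open>In dimension 0 the spectrum is empty and its \<open>Min\<close> unspecified,
      but both sides are multiples of an empty sum.\<close>
    case True
    then show ?thesis using ipx Qx by (simp add: Q_def ip_def)
  next
    case False
    have "eigenvalue A m0"
    proof (rule ccontr)
      assume "\<not> eigenvalue A m0"
      then have det: "det (char_matrix A m0) \<noteq> 0" using eigenvalue_det[OF A] by simp
      have cB: "char_matrix A m0 \<in> carrier_mat m m" using A by simp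
      define B where "B i j = A' i j - (if i = j then m0 else 0)" for i j
      have Bentry: "char_matrix A m0 $$ (i, j) = B i j" if "i < m" "j < m" for i j
        using A that by (simp add: char_matrix_def B_def A'_def)
      obtain D where D: "D \<in> carrier_mat m m" "D * char_matrix A m0 = 1\<^sub>m m"
        using det_non_zero_imp_unit[OF cB det] by (auto simp: Units_def ring_mat_def)
      have Bapp: "mat_apply m B x i = mat_apply m A' x i - m0 * x i" if "i < m" for x i
      proof -
        have "mat_apply m B x i = ip m (A' i) x - (\<Sum>j<m. (if i = j then m0 * x j else 0))"
          unfolding mat_apply_def ip_def B_def sum_subtractf[symmetric]
          by (intro sum.cong) (auto simp: algebra_simps)
        also have "(\<Sum>j<m. (if i = j then m0 * x j else 0)) = m0 * x i" using that by simp
        finally show ?thesis by (simp add: mat_apply_def)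
      qed
      have QB: "ip m x (mat_apply m B x) = Q x - m0 * ip m x x" for x
      proof -
        have "ip m x (mat_apply m B x) = ip m x (\<lambda>i. mat_apply m A' x i - m0 * x i)"
          by (intro ip_cong) (simp_all add: Bapp)
        then show ?thesis by (simp add: ip_diff_right ip_scale_right Q_def)
      qed
      have inv: "mat_apply m (\<lambda>i j. D $$ (i, j)) (mat_apply m B x) i = x i" if i: "i < m" for x i
      proof -
        let ?x = "Matrix.vec m x"
        have "?x = D *\<^sub>v (char_matrix A m0 *\<^sub>v ?x)"
          using D cB by (simp flip: assoc_mult_mat_vec[OF D(1) cB])
        then have "x i = (D *\<^sub>v (char_matrix A m0 *\<^sub>v ?x)) $ i" using i by (metis index_vec)
        also have "\<dots> = (\<Sum>j<m. D $$ (i, j) * (char_matrix A m0 *\<^sub>v ?x) $ j)"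
          using i D cB by (simp add: scalar_prod_def atLeast0LessThan)
        also have "\<dots> = (\<Sum>j<m. D $$ (i, j) * mat_apply m B x j)"
          using cB by (intro sum.cong) (simp_all add: scalar_prod_def atLeast0LessThan mat_apply_def ip_def Bentry)
        finally show ?thesis by (simp add: mat_apply_def ip_def)
      qed
      obtain \<kappa> where \<kappa>: "\<kappa> > 0" "\<And>x. \<kappa> * ip m x x \<le> ip m x (mat_apply m B x)"
      proof (rule psd_coercive[of m B "\<lambda>i j. D $$ (i, j)"])
        show "B i j = B j i" if "i < m" "j < m" for i j using sym that by (simp add: B_def A'_def)
        show "0 \<le> ip m x (mat_apply m B x)" for x using m0 by (simp add: QB)
      qed (use inv in auto)
      \<comment> \<open>Coercivity makes \<open>m0 + \<kappa>\<close> a lower bound of the form on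
        the unit sphere. The sphere contains the first coordinate vector, as m is not 0.\<close>
      have "m0 + \<kappa> \<le> m0" 
        unfolding m0_def
      proof (rule cINF_greatest, unfold m0_def[symmetric])
        have "ip m (\<lambda>i. if i = 0 then 1 else 0) (\<lambda>i. if i = 0 then 1 else 0) = (\<Sum>i<m. if i = 0 then 1 else 0)"
          unfolding ip_def by (intro sum.cong) auto
        also have "\<dots> = 1" using False by simp
        finally show "{x. ip m x x = 1} \<noteq> {}" by blast
        show "m0 + \<kappa> \<le> Q x" if "x \<in> {x. ip m x x = 1}" for x
          using \<kappa>(2)[of x] that by (simp add: QB)
      qed
      then show False using \<kappa>(1) by simp
    qed
    then have "Min (spectrum A) \<le> m0"
      using card_finite_spectrum(1)[OF A] by (intro Min_le) (auto simp: spectrum_def)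
    then have "Min (spectrum A) * scalar_prod x x \<le> m0 * scalar_prod x x"
      unfolding ipx by (intro mult_right_mono ip_self_nonneg)
    then show ?thesis using m0[of "\<lambda>i. x $ i"] by (simp add: ipx Qx)
  qed
qed

section \<open>Orthonormal bases of column spans\<close>

text \<open>Coefficients are indexed by the columns themselves, so that index sets can be enlarged
  and split without renumbering. Entries from n on are unconstrained.\<close>

definition span_of :: "nat \<Rightarrow> (nat \<Rightarrow> nat \<Rightarrow> real) \<Rightarrow> nat set \<Rightarrow> (nat \<Rightarrow> real) set" where
  "span_of n a S = {v. \<exists>c. \<forall>i<n. v i = (\<Sum>j\<in>S. a j i * c j)}"

definition proj_onto :: "nat \<Rightarrow> (nat \<Rightarrow> real) list \<Rightarrow> (nat \<Rightarrow> real) \<Rightarrow> nat \<Rightarrow> real" where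
  "proj_onto n qs v = (\<lambda>i. \<Sum>q\<leftarrow>qs. ip n q v * q i)"

definition residual :: "nat \<Rightarrow> (nat \<Rightarrow> real) list \<Rightarrow> (nat \<Rightarrow> real) \<Rightarrow> nat \<Rightarrow> real" where
  "residual n qs v = (\<lambda>i. v i - proj_onto n qs v i)"

definition is_onb :: "nat \<Rightarrow> (nat \<Rightarrow> real) list \<Rightarrow> (nat \<Rightarrow> real) set \<Rightarrow> bool" where
  "is_onb n qs V \<longleftrightarrow> orthonormal n qs \<and> set qs \<subseteq> V \<and> (\<forall>v\<in>V. \<forall>i<n. proj_onto n qs v i = v i)"

lemma span_of_cong: "v \<in> span_of n a S \<Longrightarrow> (\<And>i. i < n \<Longrightarrow> w i = v i) \<Longrightarrow> w \<in> span_of n a S"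
  by (auto simp: span_of_def)

lemma span_of_zero: "(\<lambda>_. 0) \<in> span_of n a S"
  unfolding span_of_def by (auto intro!: exI[of _ "\<lambda>_. 0"])

lemma span_of_add: "v \<in> span_of n a S \<Longrightarrow> w \<in> span_of n a S \<Longrightarrow> (\<lambda>i. v i + w i) \<in> span_of n a S"
  unfolding span_of_def
proof clarsimp
  fix c d
  assume "\<forall>i<n. v i = (\<Sum>j\<in>S. a j i * c j)" "\<forall>i<n. w i = (\<Sum>j\<in>S. a j i * d j)"
  then show "\<exists>e. \<forall>i<n. (\<Sum>j\<in>S. a j i * c j) + (\<Sum>j\<in>S. a j i * d j) = (\<Sum>j\<in>S. a j i * e j)"
    by (intro exI[of _ "\<lambda>j. c j + d j"]) (simp add: algebra_simps sum.distrib)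
qed

lemma span_of_scale: "v \<in> span_of n a S \<Longrightarrow> (\<lambda>i. t * v i) \<in> span_of n a S"
  unfolding span_of_def
proof clarsimp
  fix c
  show "\<exists>e. \<forall>i<n. t * (\<Sum>j\<in>S. a j i * c j) = (\<Sum>j\<in>S. a j i * e j)"
    by (intro exI[of _ "\<lambda>j. t * c j"]) (simp add: sum_distrib_left mult.left_commute)
qed

lemma span_of_diff: "v \<in> span_of n a S \<Longrightarrow> w \<in> span_of n a S \<Longrightarrow> (\<lambda>i. v i - w i) \<in> span_of n a S"
  using span_of_add[OF _ span_of_scale[of w n a S "-1"], of v] by simp

lemma span_of_mono:
  assumes "finite T" "S \<subseteq> T"
  shows "span_of n a S \<subseteq> span_of n a T"
  unfolding span_of_def
proof clarsimp
  fix v c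
  assume "\<forall>i<n. v i = (\<Sum>j\<in>S. a j i * c j)"
  then show "\<exists>e. \<forall>i<n. (\<Sum>j\<in>S. a j i * c j) = (\<Sum>j\<in>T. a j i * e j)"
    using assms by (intro exI[of _ "\<lambda>j. if j \<in> S then c j else 0"] allI impI)
      (auto intro!: sum.mono_neutral_cong_left)
qed

lemma span_of_base:
  assumes "finite S" "j \<in> S"
  shows "a j \<in> span_of n a S"
proof -
  have "a j i = (\<Sum>k\<in>S. a k i * (if k = j then 1 else 0))" for i
    using assms by (simp add: if_distrib[of "(*) _"] cong: if_cong)
  then have "\<forall>i<n. a j i = (\<Sum>k\<in>S. a k i * (if k = j then 1 else 0))" by blast
  then show ?thesis unfolding span_of_def by (intro CollectI exI)
qed

lemma span_of_insertE:
  assumes "finite S" "j \<notin> S" "v \<in> span_of n a (insert j S)"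
  obtains w t where "w \<in> span_of n a S" "\<And>i. i < n \<Longrightarrow> v i = w i + t * a j i"
proof -
  obtain c where c: "\<forall>i<n. v i = (\<Sum>k\<in>insert j S. a k i * c k)"
    using assms(3) by (auto simp: span_of_def)
  show thesis
  proof (rule that[of "\<lambda>i. \<Sum>k\<in>S. a k i * c k" "c j"])
    show "(\<lambda>i. \<Sum>k\<in>S. a k i * c k) \<in> span_of n a S" by (auto simp: span_of_def)
    show "v i = (\<Sum>k\<in>S. a k i * c k) + c j * a j i" if "i < n" for i
      using c that assms(1,2) by simp
  qed
qed

lemma proj_onto_Nil [simp]: "proj_onto n [] v i = 0"
  and proj_onto_Cons [simp]: "proj_onto n (q # qs) v i = ip n q v * q i + proj_onto n qs v i"
  by (simp_all add: proj_onto_def)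

lemma proj_onto_cong: "(\<And>i. i < n \<Longrightarrow> v i = w i) \<Longrightarrow> proj_onto n qs v = proj_onto n qs w"
  using ip_cong[of n _ _ v w] by (simp add: proj_onto_def)

lemma proj_onto_mem_span_of: "set qs \<subseteq> span_of n a S \<Longrightarrow> proj_onto n qs v \<in> span_of n a S"
proof (induction qs)
  case Nil
  then show ?case using span_of_zero by (simp add: proj_onto_def)
next
  case (Cons q qs)
  then have "(\<lambda>i. ip n q v * q i + proj_onto n qs v i) \<in> span_of n a S"
    by (intro span_of_add span_of_scale) auto
  then show ?case by (rule span_of_cong) simp
qed

lemma proj_onto_add: "proj_onto n qs (\<lambda>i. v i + w i) i = proj_onto n qs v i + proj_onto n qs w i"
  by (induction qs) (simp_all add: ip_add_right algebra_simps)

lemma proj_onto_scale: "proj_onto n qs (\<lambda>i. t * v i) i = t * proj_onto n qs v i"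
  by (induction qs) (simp_all add: ip_scale_right algebra_simps)

lemma ip_proj_onto_orthogonal: "(\<And>q. q \<in> set qs \<Longrightarrow> ip n w q = 0) \<Longrightarrow> ip n w (proj_onto n qs v) = 0"
proof (induction qs)
  case Nil
  then show ?case by (simp add: ip_def)
next
  case (Cons q qs)
  have "ip n w (proj_onto n (q # qs) v) = ip n w (\<lambda>i. ip n q v * q i + proj_onto n qs v i)"
    by (intro ip_cong) simp_all
  then show ?case using Cons by (simp add: ip_add_right ip_scale_right)
qed

lemma ip_proj_onto:
  "orthonormal n qs \<Longrightarrow> q \<in> set qs \<Longrightarrow> ip n q (proj_onto n qs v) = ip n q v"
proof (induction qs)
  case (Cons p qs)
  have eq: "ip n q (proj_onto n (p # qs) v) = ip n p v * ip n q p + ip n q (proj_onto n qs v)"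
    using ip_cong[of n q q "proj_onto n (p # qs) v" "\<lambda>i. ip n p v * p i + proj_onto n qs v i"]
    by (simp add: ip_add_right ip_scale_right)
  show ?case
  proof (cases "q = p")
    case True
    then show ?thesis unfolding eq using Cons.prems ip_proj_onto_orthogonal[of qs n p v] by simp
  next
    case False
    then have "ip n q p = 0" using Cons.prems by (auto simp: ip_commute[of n q p])
    then show ?thesis unfolding eq using Cons False by simp
  qed
qed simp

lemma ip_residual: "orthonormal n qs \<Longrightarrow> q \<in> set qs \<Longrightarrow> ip n q (residual n qs v) = 0"
  by (simp add: residual_def ip_diff_right ip_proj_onto)

lemma ip_self_proj_onto: "ip n v (proj_onto n qs v) = proj_sq n qs v"
proof (induction qs)
  case Nil
  then show ?case by (simp add: ip_def)
next
  case (Cons q qs)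
  have "ip n v (proj_onto n (q # qs) v) = ip n v (\<lambda>i. ip n q v * q i + proj_onto n qs v i)"
    by (intro ip_cong) simp_all
  then show ?case using Cons by (simp add: ip_add_right ip_scale_right power2_eq_square ip_commute[of n v q])
qed

lemma ip_residual_proj_onto: "orthonormal n qs \<Longrightarrow> ip n (residual n qs v) (proj_onto n qs w) = 0"
  by (rule ip_proj_onto_orthogonal) (simp add: ip_commute[of n "residual n qs v"] ip_residual)

lemma ip_residual_residual: "orthonormal n qs \<Longrightarrow> ip n (residual n qs v) (residual n qs w) = ip n (residual n qs v) w"
  using ip_residual_proj_onto[of n qs v w] by (simp add: residual_def[of n qs w] ip_diff_right)

lemma norm_residual: "orthonormal n qs \<Longrightarrow> ip n (residual n qs v) (residual n qs v) = ip n v v - proj_sq n qs v"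
  by (simp add: ip_residual_residual ip_self_proj_onto) (simp add: residual_def ip_diff_left ip_commute[of n "proj_onto n qs v"] ip_self_proj_onto)

lemma is_onb_residual_orthogonal:
  assumes "is_onb n qs V" "w \<in> V"
  shows "ip n w (residual n qs v) = 0"
proof -
  have "ip n w (residual n qs v) = ip n (proj_onto n qs w) (residual n qs v)"
    using assms by (intro ip_cong) (simp_all add: is_onb_def)
  also have "\<dots> = ip n (residual n qs v) (proj_onto n qs w)" by (rule ip_commute)
  also have "\<dots> = 0" using assms by (intro ip_residual_proj_onto) (simp add: is_onb_def)
  finally show ?thesis .
qed

text \<open>One Gram-Schmidt step. The residual \<open>d\<close> of the new column is normalised and
  prepended, unless it vanishes because the column already lies in the span; hence a length of at
  most 1.\<close>

lemma is_onb_insert: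
  assumes fin: "finite S" and j: "j \<notin> S" and qs: "is_onb n qs (span_of n a S)"
  shows "\<exists>rs. length rs \<le> 1 \<and> is_onb n (rs @ qs) (span_of n a (insert j S))"
proof -
  define d where "d = residual n qs (a j)"
  have on: "orthonormal n qs" and sub: "set qs \<subseteq> span_of n a S"
    and fixp: "\<And>v i. v \<in> span_of n a S \<Longrightarrow> i < n \<Longrightarrow> proj_onto n qs v i = v i"
    using qs by (auto simp: is_onb_def)
  have mono: "span_of n a S \<subseteq> span_of n a (insert j S)" using fin by (intro span_of_mono) auto
  have sub': "set qs \<subseteq> span_of n a (insert j S)" using sub mono by auto
  \<comment> \<open>The old projection misses \<open>v\<close> by exactly \<open>t * d i\<close>:
    nothing if \<open>d\<close> vanishes, and otherwise the component along the new vector.\<close>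
  have proj_onto_split: "proj_onto n qs v i = w i + t * (a j i - d i)"
    if "w \<in> span_of n a S" "\<And>i. i < n \<Longrightarrow> v i = w i + t * a j i" "i < n" for v w t i
  proof -
    have "proj_onto n qs v i = proj_onto n qs (\<lambda>i. w i + t * a j i) i"
      using that(2) proj_onto_cong[of n v "\<lambda>i. w i + t * a j i" qs] by simp
    then show ?thesis using fixp[OF that(1,3)] by (simp add: proj_onto_add proj_onto_scale d_def residual_def)
  qed
  show ?thesis
  proof (cases "ip n d d = 0")
    case True
    then have d0: "d i = 0" if "i < n" for i using that by (simp add: ip_self_eq_0)
    have "is_onb n qs (span_of n a (insert j S))"
      unfolding is_onb_def
    proof (intro conjI on sub' ballI allI impI)
      fix v i assume v: "v \<in> span_of n a (insert j S)" and i: "i < n"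
      obtain w t where w: "w \<in> span_of n a S" "\<And>i. i < n \<Longrightarrow> v i = w i + t * a j i"
        using span_of_insertE[OF fin j v] by blast
      show "proj_onto n qs v i = v i" using proj_onto_split[OF w i] w(2)[OF i] d0[OF i] by simp
    qed
    then show ?thesis by (intro exI[of _ "[]"]) simp
  next
    case False
    then have pos: "ip n d d > 0" using ip_self_nonneg[of n d] by linarith
    define h where "h = 1 / sqrt (ip n d d)"
    have h: "h * h * ip n d d = 1" using pos by (simp add: h_def)
    define q where "q = (\<lambda>i. h * d i)"
    have qq: "ip n q q = 1" using h by (simp add: q_def ip_scale_left ip_scale_right mult.assoc)
    have qorth: "ip n q q' = 0" if "q' \<in> set qs" for q'
      using ip_residual[OF on that, of "a j"] by (simp add: q_def d_def ip_scale_left ip_commute[of n _ q'])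
    have "d \<in> span_of n a (insert j S)"
      unfolding d_def residual_def using fin sub' by (intro span_of_diff proj_onto_mem_span_of span_of_base) auto
    then have qm: "q \<in> span_of n a (insert j S)" unfolding q_def by (rule span_of_scale)
    have da: "ip n d (a j) = ip n d d"
      using ip_residual_residual[OF on, of "a j" "a j"] by (simp add: d_def)
    have "is_onb n (q # qs) (span_of n a (insert j S))"
      unfolding is_onb_def
    proof (intro conjI ballI allI impI)
      show "orthonormal n (q # qs)" using qq qorth on by simp
      show "set (q # qs) \<subseteq> span_of n a (insert j S)" using qm sub' by simp
      fix v i assume v: "v \<in> span_of n a (insert j S)" and i: "i < n"
      obtain w t where w: "w \<in> span_of n a S" "\<And>i. i < n \<Longrightarrow> v i = w i + t * a j i"
        using span_of_insertE[OF fin j v] by blast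
      have "ip n d v = ip n d (\<lambda>i. w i + t * a j i)" by (intro ip_cong) (simp_all add: w(2))
      also have "\<dots> = t * ip n d d"
        using is_onb_residual_orthogonal[OF qs w(1), of "a j"]
        by (simp add: ip_add_right ip_scale_right da ip_commute[of n d w] flip: d_def)
      finally have "ip n q v * q i = (h * h * ip n d d) * t * d i"
        by (simp add: q_def ip_scale_left)
      then have "ip n q v * q i = t * d i" using h by simp
      then show "proj_onto n (q # qs) v i = v i" using proj_onto_split[OF w i] w(2)[OF i] by (simp add: algebra_simps)
    qed
    then show ?thesis by (intro exI[of _ "[q]"]) simp
  qed
qed

text \<open>Keeping \<open>qs\<close> as a suffix lets the bases for S and for the true support
  extend one common basis, whose contribution then cancels in the difference of residual sums. The
  number of added vectors later enters the tail bound.\<close>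

lemma is_onb_extend:
  assumes "finite T" "finite S" "S \<inter> T = {}" "is_onb n qs (span_of n a S)"
  shows "\<exists>rs. length rs \<le> card T \<and> is_onb n (rs @ qs) (span_of n a (S \<union> T))"
  using assms(1,3)
proof (induction T)
  case empty
  then show ?case using assms(4) by (intro exI[of _ "[]"]) simp
next
  case (insert j T)
  then obtain rs where rs: "length rs \<le> card T" "is_onb n (rs @ qs) (span_of n a (S \<union> T))" by auto
  have "j \<notin> S \<union> T" "finite (S \<union> T)" using insert assms(2) by auto
  then obtain ps where "length ps \<le> 1" "is_onb n (ps @ rs @ qs) (span_of n a (insert j (S \<union> T)))"
    using is_onb_insert[OF _ _ rs(2)] by blast
  then show ?case using rs(1) insert by (intro exI[of _ "ps @ rs"]) auto
qed

lemma is_onb_empty: "is_onb n [] (span_of n a {})"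
  by (auto simp: is_onb_def span_of_def)

lemma orthonormal_append_left: "orthonormal n (rs @ qs) \<Longrightarrow> orthonormal n rs"
  by (induction rs) auto

text \<open>
  The fits \<open>P\<^bsub>S\<^esub>\<close> and \<open>P\<^bsub>S0\<^esub>\<close> share the projection onto the span of the common columns, so
  \<open>P\<^bsub>S\<^esub> - P\<^bsub>S0\<^esub>\<close> is at most the projection along the extra directions \<open>rs\<close>. The direction of the bias
  \<open>\<mu>\<close> absorbs the cross term by AM-GM.
\<close>

lemma rss_diff_lower_bound:
  assumes qS: "is_onb n (rs @ qs) (span_of n a S)" and q0: "is_onb n (rs0 @ qs) (span_of n a S0)"
    and f: "f \<in> span_of n a S0"
  defines "\<mu> \<equiv> residual n (rs @ qs) f"
  shows "\<exists>Q. orthonormal n Q \<and> length Q \<le> length rs + 1 \<and>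
    (\<forall>e y. (\<forall>i<n. y i = f i + e i) \<longrightarrow>
      ip n \<mu> \<mu> / 2 - 2 * proj_sq n Q e
        \<le> ip n (residual n (rs @ qs) y) (residual n (rs @ qs) y) - ip n (residual n (rs0 @ qs) y) (residual n (rs0 @ qs) y))"
proof -
  define h where "h = 1 / sqrt (ip n \<mu> \<mu>)"
  define u where "u = (\<lambda>i. h * \<mu> i)"
  \<comment> \<open>Without bias there is no direction to normalise, and \<open>rs\<close> alone
    suffices.\<close>
  define Q where "Q = (if ip n \<mu> \<mu> = 0 then rs else u # rs)"
  have on: "orthonormal n (rs @ qs)" and on0: "orthonormal n (rs0 @ qs)"
    using qS q0 by (auto simp: is_onb_def)
  have onQ: "orthonormal n Q"
  proof (cases "ip n \<mu> \<mu> = 0")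
    case True
    then show ?thesis using orthonormal_append_left[OF on] by (simp add: Q_def)
  next
    case False
    then have "h * h * ip n \<mu> \<mu> = 1"
      using ip_self_nonneg[of n \<mu>] by (simp add: h_def)
    then have "ip n u u = 1" by (simp add: u_def ip_scale_left ip_scale_right mult.assoc)
    moreover have "ip n u r = 0" if "r \<in> set rs" for r
      using ip_residual[OF on, of r f] that by (simp add: u_def ip_scale_left \<mu>_def ip_commute[of n r])
    ultimately show ?thesis using False orthonormal_append_left[OF on] by (simp add: Q_def)
  qed
  have bound: "ip n \<mu> \<mu> / 2 - 2 * proj_sq n Q e
      \<le> ip n (residual n (rs @ qs) y) (residual n (rs @ qs) y) - ip n (residual n (rs0 @ qs) y) (residual n (rs0 @ qs) y)"
    if y: "\<forall>i<n. y i = f i + e i" for e y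
  proof -
    have residual_y: "residual n ps y i = residual n ps f i + residual n ps e i" if "i < n" for ps i
      using proj_onto_cong[of n y "\<lambda>i. f i + e i" ps] y that by (simp add: residual_def proj_onto_add)
    \<comment> \<open>The true model has no bias, so its residual is pure noise; the gain along
      \<open>rs0\<close> is then discarded.\<close>
    have residual_f: "residual n (rs0 @ qs) f i = 0" if "i < n" for i
      using q0 f that by (simp add: is_onb_def residual_def)
    have "ip n (residual n (rs0 @ qs) y) (residual n (rs0 @ qs) y) = ip n (residual n (rs0 @ qs) e) (residual n (rs0 @ qs) e)"
      by (intro ip_cong) (simp_all add: residual_y residual_f)
    also have "\<dots> = ip n e e - proj_sq n rs0 e - proj_sq n qs e" by (simp add: norm_residual[OF on0])
    finally have 1: "ip n (residual n (rs0 @ qs) y) (residual n (rs0 @ qs) y) \<le> ip n e e - proj_sq n qs e"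
      using proj_sq_nonneg[of n rs0 e] by simp
    have "ip n (residual n (rs @ qs) y) (residual n (rs @ qs) y)
        = ip n (\<lambda>i. \<mu> i + residual n (rs @ qs) e i) (\<lambda>i. \<mu> i + residual n (rs @ qs) e i)"
      by (intro ip_cong) (simp_all add: residual_y \<mu>_def)
    also have "\<dots> = ip n \<mu> \<mu> + 2 * ip n \<mu> (residual n (rs @ qs) e) + ip n (residual n (rs @ qs) e) (residual n (rs @ qs) e)"
      by (simp add: ip_add_left ip_add_right ip_commute[of n "residual n (rs @ qs) e" \<mu>])
    also have "\<dots> = ip n \<mu> \<mu> + 2 * ip n \<mu> e + ip n e e - proj_sq n rs e - proj_sq n qs e"
      by (simp add: norm_residual[OF on]) (simp add: \<mu>_def ip_residual_residual[OF on])
    finally have 2: "ip n (residual n (rs @ qs) y) (residual n (rs @ qs) y)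
        = ip n \<mu> \<mu> + 2 * ip n \<mu> e + ip n e e - proj_sq n rs e - proj_sq n qs e" .
    \<comment> \<open>With N the length of \<mu>, the inequality 2 N \<langle>u, e\<rangle> \<ge> -
      N^2 / 2 - 2 \<langle>u, e\<rangle>^2 spends half of the squared bias and causes the factor 2
      in front of \<open>proj_sq n Q e\<close>; along \<open>rs\<close> a factor 1 would do.\<close>
    have 3: "- (ip n \<mu> \<mu> / 2) - 2 * proj_sq n Q e \<le> 2 * ip n \<mu> e - proj_sq n rs e"
    proof (cases "ip n \<mu> \<mu> = 0")
      case True
      then have "ip n \<mu> e = 0" by (simp add: ip_self_eq_0) (simp add: ip_def)
      then show ?thesis using True proj_sq_nonneg[of n rs e] by (simp add: Q_def)
    next
      case False
      define N where "N = sqrt (ip n \<mu> \<mu>)"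
      have N: "N > 0" "N\<^sup>2 = ip n \<mu> \<mu>" using False ip_self_nonneg[of n \<mu>] by (simp_all add: N_def)
      have "N * h = 1" using N(1) by (simp add: h_def flip: N_def)
      then have ue: "ip n \<mu> e = N * ip n u e" by (simp add: u_def ip_scale_left flip: mult.assoc)
      have "0 \<le> (N / 2 + ip n u e)\<^sup>2 * 2" by simp
      also have "\<dots> = N\<^sup>2 / 2 + 2 * (N * ip n u e) + 2 * (ip n u e)\<^sup>2"
        by (simp add: power2_eq_square algebra_simps)
      finally show ?thesis using False N proj_sq_nonneg[of n rs e] by (simp add: Q_def ue)
    qed
    show ?thesis using 1 2 3 by linarith
  qed
  show ?thesis
    using onQ bound by (intro exI[of _ Q]) (auto simp: Q_def)
qed

section \<open>Projections and restricted eigenvalues\<close>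

unbundle no vec_syntax

abbreviation mat_cols :: "real mat \<Rightarrow> nat \<Rightarrow> nat \<Rightarrow> real" where
  "mat_cols X \<equiv> \<lambda>j i. X $$ (i, j)"

lemma scalar_prod_eq_ip: "w \<in> carrier_vec n \<Longrightarrow> scalar_prod v w = ip n (\<lambda>i. v $ i) (\<lambda>i. w $ i)"
  by (simp add: scalar_prod_def ip_def atLeast0LessThan)

text \<open>Counting the smaller elements of S inverts \<open>pick\<close>. This turns sums over
  positions in \<open>col_sub\<close> into sums over column indices.\<close>

lemma bij_betw_pick:
  assumes "finite S"
  shows "bij_betw (pick S) {..<card S} S"
proof (rule bij_betw_byWitness[where f' = "\<lambda>j. card {a \<in> S. a < j}"])
  show "\<forall>k\<in>{..<card S}. card {a \<in> S. a < pick S k} = k" by (simp add: card_pick)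
  show "\<forall>j\<in>S. pick S (card {a \<in> S. a < j}) = j" by (simp add: pick_card_in_set)
  show "pick S ` {..<card S} \<subseteq> S" by (auto simp: pick_in_set)
  show "(\<lambda>j. card {a \<in> S. a < j}) ` S \<subseteq> {..<card S}"
    using assms by (auto intro!: psubset_card_mono)
qed

lemma col_sub_carrier:
  assumes "X \<in> carrier_mat n p" "S \<subseteq> {..<p}"
  shows "col_sub X S \<in> carrier_mat n (card S)"
proof -
  have "{j. j < p \<and> j \<in> S} = S" using assms(2) by auto
  then show ?thesis using assms(1) by (intro carrier_matI) (simp_all add: col_sub_def dim_submatrix)
qed

lemma col_sub_index:
  assumes "X \<in> carrier_mat n p" "S \<subseteq> {..<p}" "i < n" "k < card S"
  shows "col_sub X S $$ (i, k) = X $$ (i, pick S k)"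
proof -
  have "{j. j < p \<and> j \<in> S} = S" using assms(2) by auto
  then show ?thesis using assms by (simp add: col_sub_def submatrix_index pick_UNIV)
qed

lemma col_sub_mult_vec:
  assumes X: "X \<in> carrier_mat n p" "S \<subseteq> {..<p}"
  shows "col_sub X S *\<^sub>v Matrix.vec (card S) (\<lambda>k. c (pick S k)) = Matrix.vec n (\<lambda>i. \<Sum>j\<in>S. X $$ (i, j) * c j)"
proof (rule eq_vecI)
  have fin: "finite S" using X(2) finite_subset by blast
  note carr = col_sub_carrier[OF X]
  fix i assume "i < dim_vec (Matrix.vec n (\<lambda>i. \<Sum>j\<in>S. X $$ (i, j) * c j))"
  then have i: "i < n" by simp
  then have "(col_sub X S *\<^sub>v Matrix.vec (card S) (\<lambda>k. c (pick S k))) $ i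
      = (\<Sum>k<card S. X $$ (i, pick S k) * c (pick S k))"
    using carr by (simp add: scalar_prod_def atLeast0LessThan col_sub_index[OF X])
  also have "\<dots> = (\<Sum>j\<in>S. X $$ (i, j) * c j)"
    by (rule sum.reindex_bij_betw[OF bij_betw_pick[OF fin]])
  finally show "(col_sub X S *\<^sub>v Matrix.vec (card S) (\<lambda>k. c (pick S k))) $ i
      = Matrix.vec n (\<lambda>i. \<Sum>j\<in>S. X $$ (i, j) * c j) $ i" using i by simp
qed (use col_sub_carrier[OF X] in simp)

lemma col_space_col_sub:
  assumes X: "X \<in> carrier_mat n p" "S \<subseteq> {..<p}"
  shows "vec_space.col_space n (col_sub X S) = {v \<in> carrier_vec n. (\<lambda>i. v $ i) \<in> span_of n (mat_cols X) S}"
proof -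
  interpret vec_space "TYPE(real)" n .
  have carr: "col_sub X S \<in> carrier_mat n (card S)" by (rule col_sub_carrier[OF X])
  have "(\<exists>x\<in>carrier_vec (card S). col_sub X S *\<^sub>v x = v) \<longleftrightarrow> (\<lambda>i. v $ i) \<in> span_of n (mat_cols X) S"
    if v: "v \<in> carrier_vec n" for v
  proof
    assume "\<exists>x\<in>carrier_vec (card S). col_sub X S *\<^sub>v x = v"
    then obtain x where x: "x \<in> carrier_vec (card S)" "col_sub X S *\<^sub>v x = v" by blast
    \<comment> \<open>The coefficient of column j stands at the position of j within S, which is the
      number of smaller elements of S.\<close>
    have xeq: "Matrix.vec (card S) (\<lambda>k. x $ card {a \<in> S. a < pick S k}) = x"
      using x(1) by (intro eq_vecI) (simp_all add: card_pick)
    have veq: "v = Matrix.vec n (\<lambda>i. \<Sum>j\<in>S. X $$ (i, j) * x $ card {a \<in> S. a < j})"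
      using col_sub_mult_vec[OF X, of "\<lambda>j. x $ card {a \<in> S. a < j}"] unfolding xeq x(2) .
    have "\<forall>i<n. v $ i = (\<Sum>j\<in>S. X $$ (i, j) * x $ card {a \<in> S. a < j})"
      by (subst veq) simp
    then show "(\<lambda>i. v $ i) \<in> span_of n (mat_cols X) S" unfolding span_of_def
      by (intro CollectI exI[of _ "\<lambda>j. x $ card {a \<in> S. a < j}"])
  next
    assume "(\<lambda>i. v $ i) \<in> span_of n (mat_cols X) S"
    then obtain c where c: "\<forall>i<n. v $ i = (\<Sum>j\<in>S. X $$ (i, j) * c j)" by (auto simp: span_of_def)
    then have "col_sub X S *\<^sub>v Matrix.vec (card S) (\<lambda>k. c (pick S k)) = v"
      unfolding col_sub_mult_vec[OF X] using v by (intro eq_vecI) simp_all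
    then show "\<exists>x\<in>carrier_vec (card S). col_sub X S *\<^sub>v x = v" by (intro bexI[OF _ vec_carrier])
  qed
  then have "{v \<in> carrier_vec n. \<exists>x\<in>carrier_vec (card S). col_sub X S *\<^sub>v x = v}
      = {v \<in> carrier_vec n. (\<lambda>i. v $ i) \<in> span_of n (mat_cols X) S}"
    by (intro Collect_cong conj_cong refl)
  then show ?thesis unfolding col_space_eq[OF carr] carrier_matD[OF carr] .
qed

text \<open>The matrix P, the sum of q q^T over the basis, meets the description in
  \<open>orth_proj\<close>. It is the only one: two candidates send v to points of V whose
  difference is orthogonal to V, hence zero. Dependent columns do no harm, since the basis is
  orthonormal by construction.\<close>

lemma orth_proj_mult_vec:
  assumes is_onb: "is_onb n qs (span_of n a S)"
  defines "V \<equiv> {v \<in> carrier_vec n. (\<lambda>i. v $ i) \<in> span_of n a S}"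
  shows "orth_proj n V \<in> carrier_mat n n"
    and "\<And>v. v \<in> carrier_vec n \<Longrightarrow> orth_proj n V *\<^sub>v v = Matrix.vec n (proj_onto n qs (\<lambda>i. v $ i))"
proof -
  define P where "P = Matrix.mat n n (\<lambda>(i, k). \<Sum>q\<leftarrow>qs. q i * q k)"
  have P: "P \<in> carrier_mat n n" by (simp add: P_def)
  have Pv: "P *\<^sub>v v = Matrix.vec n (proj_onto n qs (\<lambda>i. v $ i))" if v: "v \<in> carrier_vec n" for v
  proof (rule eq_vecI)
    have "(\<Sum>k<n. (\<Sum>q\<leftarrow>ps. q i * q k) * v $ k) = proj_onto n ps (\<lambda>i. v $ i) i" for ps :: "(nat \<Rightarrow> real) list" and i
      by (induction ps) (simp_all add: algebra_simps sum.distrib ip_def sum_distrib_left)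
    then show "(P *\<^sub>v v) $ i = Matrix.vec n (proj_onto n qs (\<lambda>i. v $ i)) $ i"
      if "i < dim_vec (Matrix.vec n (proj_onto n qs (\<lambda>i. v $ i)))" for i
      using that v by (simp add: P_def scalar_prod_def atLeast0LessThan)
  qed (simp add: P_def)
  have orth: "scalar_prod (v - P *\<^sub>v v) w = 0" if v: "v \<in> carrier_vec n" and w: "w \<in> V" for v w
  proof -
    have "scalar_prod (v - P *\<^sub>v v) w = ip n (residual n qs (\<lambda>i. v $ i)) (\<lambda>i. w $ i)"
      using v w by (subst scalar_prod_eq_ip[of _ n]) (auto simp: Pv V_def residual_def intro!: ip_cong)
    also have "\<dots> = 0" using is_onb_residual_orthogonal[OF is_onb, of "\<lambda>i. w $ i"] w by (simp add: V_def ip_commute)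
    finally show ?thesis .
  qed
  have mem: "P *\<^sub>v v \<in> V" if v: "v \<in> carrier_vec n" for v
  proof -
    have "proj_onto n qs (\<lambda>i. v $ i) \<in> span_of n a S" using is_onb by (intro proj_onto_mem_span_of) (simp add: is_onb_def)
    then have "(\<lambda>i. (P *\<^sub>v v) $ i) \<in> span_of n a S" by (rule span_of_cong) (simp add: Pv[OF v])
    then show ?thesis by (simp add: V_def Pv[OF v])
  qed
  have "orth_proj n V = P"
    unfolding orth_proj_def
  proof (rule the_equality)
    show "P \<in> carrier_mat n n \<and> (\<forall>v\<in>carrier_vec n. P *\<^sub>v v \<in> V \<and> (\<forall>w\<in>V. scalar_prod (v - P *\<^sub>v v) w = 0))"
      using P mem orth by blast
    fix P' assume *: "P' \<in> carrier_mat n n \<and> (\<forall>v\<in>carrier_vec n. P' *\<^sub>v v \<in> V \<and> (\<forall>w\<in>V. scalar_prod (v - P' *\<^sub>v v) w = 0))"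
    have eq: "P' *\<^sub>v v = P *\<^sub>v v" if v: "v \<in> carrier_vec n" for v
    proof -
      let ?p = "\<lambda>i. (P *\<^sub>v v) $ i" and ?p' = "\<lambda>i. (P' *\<^sub>v v) $ i" and ?v = "\<lambda>i. v $ i"
      have carr: "P *\<^sub>v v \<in> carrier_vec n" "P' *\<^sub>v v \<in> carrier_vec n"
        and dims: "dim_row P = n" "dim_row P' = n"
        using P * v by auto
      have ips: "ip n (\<lambda>i. ?v i - ?p i) (\<lambda>i. w $ i) = 0" "ip n (\<lambda>i. ?v i - ?p' i) (\<lambda>i. w $ i) = 0"
        if w: "w \<in> V" for w
      proof -
        have wc: "w \<in> carrier_vec n" using w by (simp add: V_def)
        have "scalar_prod (v - P *\<^sub>v v) w = 0" "scalar_prod (v - P' *\<^sub>v v) w = 0"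
          using orth[OF v w] * v w by auto
        moreover have "scalar_prod (v - P *\<^sub>v v) w = ip n (\<lambda>i. ?v i - ?p i) (\<lambda>i. w $ i)"
          "scalar_prod (v - P' *\<^sub>v v) w = ip n (\<lambda>i. ?v i - ?p' i) (\<lambda>i. w $ i)"
          unfolding scalar_prod_eq_ip[OF wc] using dims v
          by (auto intro!: ip_cong simp del: index_mult_mat_vec)
        ultimately show "ip n (\<lambda>i. ?v i - ?p i) (\<lambda>i. w $ i) = 0" "ip n (\<lambda>i. ?v i - ?p' i) (\<lambda>i. w $ i) = 0"
          by simp_all
      qed
      \<comment> \<open>Test both residuals against both fits; the four vanishing products combine
        to the squared distance of the fits.\<close>
      have "P *\<^sub>v v \<in> V" "P' *\<^sub>v v \<in> V" using mem[OF v] * v by auto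
      note this[THEN ips(1)] this[THEN ips(2)]
      then have "ip n (\<lambda>i. ?p i - ?p' i) (\<lambda>i. ?p i - ?p' i) = 0"
        unfolding ip_diff_left ip_diff_right by linarith
      then show ?thesis using dims
        by (intro eq_vecI) (auto simp: ip_self_eq_0 simp del: index_mult_mat_vec)
    qed
    show "P' = P"
    proof (rule mat_col_eqI)
      show "col P' i = col P i" if "i < dim_col P" for i
      proof -
        have i: "i < n" using that P by simp
        have P': "P' \<in> carrier_mat n n" using * by blast
        have "col P' i = P' *\<^sub>v col (1\<^sub>m n) i"
          using col_mult2[OF P' one_carrier_mat i] unfolding right_mult_one_mat[OF P'] .
        also have "\<dots> = P *\<^sub>v col (1\<^sub>m n) i" using i by (intro eq) simp
        also have "\<dots> = col P i"
          using col_mult2[OF P one_carrier_mat i] unfolding right_mult_one_mat[OF P] by simp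
        finally show ?thesis .
      qed
    qed (use P * in auto)
  qed
  then show "orth_proj n V \<in> carrier_mat n n"
    and "\<And>v. v \<in> carrier_vec n \<Longrightarrow> orth_proj n V *\<^sub>v v = Matrix.vec n (proj_onto n qs (\<lambda>i. v $ i))"
    using P Pv by auto
qed

lemma resid_proj_mult_vec:
  assumes X: "X \<in> carrier_mat n p" "S \<subseteq> {..<p}" and is_onb: "is_onb n qs (span_of n (mat_cols X) S)"
  shows "resid_proj X S \<in> carrier_mat n n"
    and "\<And>v. v \<in> carrier_vec n \<Longrightarrow> resid_proj X S *\<^sub>v v = Matrix.vec n (residual n qs (\<lambda>i. v $ i))"
proof -
  note P = orth_proj_mult_vec[OF is_onb, folded col_space_col_sub[OF X]]
  have dr: "dim_row X = n" using X(1) by simp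
  show "resid_proj X S \<in> carrier_mat n n"
    using P(1) by (auto simp: resid_proj_def dr)
  show "resid_proj X S *\<^sub>v v = Matrix.vec n (residual n qs (\<lambda>i. v $ i))" if v: "v \<in> carrier_vec n" for v
  proof -
    have "resid_proj X S *\<^sub>v v = v - Matrix.vec n (proj_onto n qs (\<lambda>i. v $ i))"
      using P v by (simp add: resid_proj_def dr minus_mult_distrib_mat_vec[of _ n n])
    then show ?thesis using v by (intro eq_vecI) (simp_all add: residual_def)
  qed
qed

lemma RSS_eq:
  assumes "X \<in> carrier_mat n p" "S \<subseteq> {..<p}" "is_onb n qs (span_of n (mat_cols X) S)" "y \<in> carrier_vec n"
  shows "RSS X y S = ip n (residual n qs (\<lambda>i. y $ i)) (residual n qs (\<lambda>i. y $ i))"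
  unfolding RSS_def resid_proj_mult_vec(2)[OF assms]
  by (subst scalar_prod_eq_ip[of _ n]) (auto intro: ip_cong)

lemma smult_mat_mult_vec:
  fixes A :: "'a :: comm_semiring_1 mat"
  assumes "A \<in> carrier_mat m n" "v \<in> carrier_vec n"
  shows "(k \<cdot>\<^sub>m A) *\<^sub>v v = k \<cdot>\<^sub>v (A *\<^sub>v v)"
  using assms by (intro eq_vecI) (auto simp: scalar_prod_def sum_distrib_left mult.assoc)

text \<open>Rayleigh's principle at the coefficient vector x of \<open>f\<close>. As the residual
  projection R is symmetric and idempotent, the form of Y^T R Y at x is the squared length of R Y x,
  and Y x is \<open>f\<close>.\<close>

lemma lambda_min_le_residual:
  fixes c :: "nat \<Rightarrow> real"
  assumes X: "X \<in> carrier_mat n p" and S: "S \<subseteq> {..<p}" and U: "U \<subseteq> {..<p}"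
    and is_onb: "is_onb n qs (span_of n (mat_cols X) S)"
  defines "f \<equiv> \<lambda>i. \<Sum>j\<in>U. X $$ (i, j) * c j"
  shows "lambda_min ((1 / real n) \<cdot>\<^sub>m (transpose_mat (col_sub X U) * resid_proj X S * col_sub X U))
           * (\<Sum>j\<in>U. (c j)\<^sup>2) \<le> ip n (residual n qs f) (residual n qs f) / real n"
proof -
  define m where "m = card U"
  define Y where "Y = col_sub X U"
  define R where "R = resid_proj X S"
  define A where "A = (1 / real n) \<cdot>\<^sub>m (transpose_mat Y * R * Y)"
  define x where "x = Matrix.vec m (\<lambda>k. c (pick U k))"
  have fin: "finite U" using U finite_subset by blast
  have Y: "Y \<in> carrier_mat n m" unfolding Y_def m_def by (rule col_sub_carrier[OF X U])
  have R: "R \<in> carrier_mat n n" and Rv: "\<And>v. v \<in> carrier_vec n \<Longrightarrow> R *\<^sub>v v = Matrix.vec n (residual n qs (\<lambda>i. v $ i))"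
    using resid_proj_mult_vec[OF X S is_onb] by (auto simp: R_def)
  have on: "orthonormal n qs" using is_onb by (simp add: is_onb_def)
  have x: "x \<in> carrier_vec m" by (simp add: x_def)
  have A: "A \<in> carrier_mat m m" using Y R by (auto simp: A_def)
  \<comment> \<open>Symmetry and idempotence of R in one identity.\<close>
  have Rip: "scalar_prod v (R *\<^sub>v w) = ip n (residual n qs (\<lambda>i. w $ i)) (residual n qs (\<lambda>i. v $ i))"
    if v: "v \<in> carrier_vec n" and w: "w \<in> carrier_vec n" for v w
  proof -
    have "scalar_prod v (R *\<^sub>v w) = ip n (\<lambda>i. v $ i) (residual n qs (\<lambda>i. w $ i))"
      by (subst scalar_prod_eq_ip[of _ n]) (use R v w in \<open>auto simp: Rv simp del: index_mult_mat_vec intro: ip_cong\<close>)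
    also have "\<dots> = ip n (residual n qs (\<lambda>i. w $ i)) (\<lambda>i. v $ i)" by (rule ip_commute)
    finally show ?thesis by (simp only: ip_residual_residual[OF on])
  qed
  have assoc: "transpose_mat Y * R * Y = transpose_mat Y * (R * Y)"
    using Y R by (intro assoc_mult_mat) auto
  \<comment> \<open>Up to the factor 1 / n this is the Gram matrix of the column residuals, which
    makes its symmetry evident.\<close>
  have Aentry: "A $$ (k, l) = (1 / real n) * ip n (residual n qs (\<lambda>i. col Y l $ i)) (residual n qs (\<lambda>i. col Y k $ i))"
    if "k < m" "l < m" for k l
  proof -
    have "(transpose_mat Y * (R * Y)) $$ (k, l) = scalar_prod (col Y k) (R *\<^sub>v col Y l)"
      using Y R that col_mult2[OF R Y] by (simp add: mult_mat_vec_def)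
    also have "\<dots> = ip n (residual n qs (\<lambda>i. col Y l $ i)) (residual n qs (\<lambda>i. col Y k $ i))"
      using Y that by (intro Rip) auto
    finally show ?thesis using Y R that by (simp add: A_def assoc del: index_mult_mat(1))
  qed
  have sym: "A $$ (k, l) = A $$ (l, k)" if "k < m" "l < m" for k l
    using that by (simp add: Aentry ip_commute)
  have Yx: "Y *\<^sub>v x = Matrix.vec n f"
    unfolding Y_def x_def m_def f_def by (rule col_sub_mult_vec[OF X U])
  have Yxc: "Y *\<^sub>v x \<in> carrier_vec n" using Y x by simp
  have "scalar_prod x (A *\<^sub>v x) = (1 / real n) * scalar_prod x (transpose_mat Y *\<^sub>v (R *\<^sub>v (Y *\<^sub>v x)))"
  proof -
    have "A *\<^sub>v x = (1 / real n) \<cdot>\<^sub>v ((transpose_mat Y * (R * Y)) *\<^sub>v x)"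
      unfolding A_def assoc using Y R x by (intro smult_mat_mult_vec) auto
    also have "(transpose_mat Y * (R * Y)) *\<^sub>v x = transpose_mat Y *\<^sub>v ((R * Y) *\<^sub>v x)"
      using Y R x by (intro assoc_mult_mat_vec) auto
    also have "(R * Y) *\<^sub>v x = R *\<^sub>v (Y *\<^sub>v x)"
      by (rule assoc_mult_mat_vec[OF R Y x])
    finally have "A *\<^sub>v x = (1 / real n) \<cdot>\<^sub>v (transpose_mat Y *\<^sub>v (R *\<^sub>v (Y *\<^sub>v x)))" .
    moreover have "transpose_mat Y *\<^sub>v (R *\<^sub>v (Y *\<^sub>v x)) \<in> carrier_vec m"
      using Y by (intro carrier_vecI) simp
    ultimately show ?thesis using scalar_prod_smult_distrib[OF x] by metis
  qed
  also have "scalar_prod x (transpose_mat Y *\<^sub>v (R *\<^sub>v (Y *\<^sub>v x))) = scalar_prod (R *\<^sub>v (Y *\<^sub>v x)) (Y *\<^sub>v x)"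
  proof -
    have "transpose_mat Y *\<^sub>v (R *\<^sub>v (Y *\<^sub>v x)) \<in> carrier_vec m"
      using Y by (intro carrier_vecI) simp
    then have "scalar_prod x (transpose_mat Y *\<^sub>v (R *\<^sub>v (Y *\<^sub>v x)))
        = scalar_prod (transpose_mat Y *\<^sub>v (R *\<^sub>v (Y *\<^sub>v x))) x"
      by (rule comm_scalar_prod[OF x])
    also have "\<dots> = scalar_prod (R *\<^sub>v (Y *\<^sub>v x)) (Y *\<^sub>v x)"
      by (rule transpose_vec_mult_scalar[OF Y x mult_mat_vec_carrier[OF R Yxc]])
    finally show ?thesis .
  qed
  also have "\<dots> = scalar_prod (Y *\<^sub>v x) (R *\<^sub>v (Y *\<^sub>v x))"
    using R Yxc by (intro comm_scalar_prod[of _ n]) auto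
  also have "\<dots> = ip n (residual n qs (\<lambda>i. (Y *\<^sub>v x) $ i)) (residual n qs (\<lambda>i. (Y *\<^sub>v x) $ i))"
    by (rule Rip[OF Yxc Yxc])
  also have "\<dots> = ip n (residual n qs f) (residual n qs f)"
    using proj_onto_cong[of n "\<lambda>i. (Y *\<^sub>v x) $ i" f qs] unfolding Yx by (intro ip_cong) (simp_all add: residual_def)
  finally have 1: "scalar_prod x (A *\<^sub>v x) = ip n (residual n qs f) (residual n qs f) / real n" by simp
  have "scalar_prod x x = (\<Sum>k<m. (c (pick U k))\<^sup>2)"
    by (simp add: scalar_prod_def x_def atLeast0LessThan power2_eq_square)
  also have "\<dots> = (\<Sum>j\<in>U. (c j)\<^sup>2)"
    unfolding m_def by (rule sum.reindex_bij_betw[OF bij_betw_pick[OF fin]])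
  finally show ?thesis
    using min_spectrum_le_quadratic_form[OF A sym x] 1
    by (simp add: lambda_min_def A_def Y_def R_def)
qed

section \<open>The union bound over models\<close>

text \<open>Subtracting 1 / p makes the induction telescope; for p = 0 this term is 0 by the
  convention on division.\<close>

lemma sum_inverse_squares_le: "(\<Sum>k=1..p. 1 / (real k)\<^sup>2) \<le> 2 - 1 / real p"
proof (induction p)
  case (Suc p)
  show ?case
  proof (cases "p = 0")
    case False
    have "1 / (real (Suc p))\<^sup>2 \<le> 1 / (real p * real (Suc p))"
      using False by (intro divide_left_mono) (auto simp: power2_eq_square)
    also have "\<dots> = 1 / real p - 1 / real (Suc p)" using False by (simp add: field_simps)
    finally show ?thesis using Suc by simp
  qed simp
qed simp

lemma sum_inverse_ranks_le:
  assumes "bij_betw r {..<p} {1..p}"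
  shows "(\<Sum>i<p. 1 / (real (r i))\<^sup>2) \<le> 2"
proof -
  have "(\<Sum>i<p. 1 / (real (r i))\<^sup>2) = (\<Sum>k=1..p. 1 / (real k)\<^sup>2)"
    by (rule sum.reindex_bij_betw[OF assms])
  also have "\<dots> \<le> 2 - 1 / real p" by (rule sum_inverse_squares_le)
  finally show ?thesis by (simp add: order_trans)
qed

lemma ln_ln_3_pos: "ln (ln 3) > (0 :: real)"
  using ln3_gt_1 by simp

lemma log_star_ge:
  assumes "t \<ge> 1"
  shows "log_star t \<ge> ln t + 2 * ln (ln 3)"
proof -
  have "ln 3 \<le> ln (t + 2)" using assms by simp
  moreover have "ln 3 > (0 :: real)" by simp
  ultimately have "ln (ln 3) \<le> ln (ln (t + 2))" by (metis ln_mono)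
  then show ?thesis by (simp add: log_star_def)
qed

text \<open>
  The surplus over 2 turns the lower bound \<open>2 log log 3\<close> on all code lengths into a factor
  \<open>1 / e\<close>, which pays for the factor 2 of each false positive.
\<close>

definition union_const :: real where
  "union_const = 2 + 1 / (2 * ln (ln 3))"

lemma union_const_ge_2: "union_const \<ge> 2"
  using ln_ln_3_pos by (simp add: union_const_def)

text \<open>With g = 2 ln (ln 3), the weighted code length is 2 C + C / g, and both C \<ge> ln r and
  C \<ge> g hold. The first part yields the inverse square of the rank, the second a factor 1 / e,
  which absorbs the 2.\<close>

lemma exp_code_len_le:
  assumes "r i \<ge> 1"
  shows "2 * exp (- union_const * code_len r i) \<le> 1 / (real (r i))\<^sup>2"
proof -
  have ri: "real (r i) \<ge> 1" using assms by simp
  define g where "g = 2 * ln (ln 3 :: real)"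
  have g: "g > 0" using ln_ln_3_pos by (simp add: g_def)
  define C where "C = code_len r i"
  have "C \<ge> ln (real (r i)) + g" using log_star_ge[OF ri] by (simp add: C_def code_len_def g_def)
  moreover have "ln (real (r i)) \<ge> 0" using ri by simp
  ultimately have C: "C \<ge> ln (real (r i))" "C \<ge> g" using g by linarith+
  have "union_const * C = 2 * C + C / g" by (simp add: union_const_def g_def algebra_simps)
  moreover have "C / g \<ge> 1" using C(2) g by simp
  ultimately have "- union_const * C \<le> - 1 - 2 * ln (real (r i))" using C(1) by simp
  then have "exp (- union_const * C) \<le> exp (- 1 - 2 * ln (real (r i)))" by simp
  also have "\<dots> = exp (- 1) * inverse ((exp (ln (real (r i))))\<^sup>2)"
    by (simp add: exp_diff exp_double field_simps exp_minus)
  also have "exp (ln (real (r i))) = real (r i)" using ri by simp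
  finally have *: "exp (- union_const * C) \<le> exp (- 1) * inverse ((real (r i))\<^sup>2)" .
  have "(2 :: real) \<le> exp 1" using exp_ge_add_one_self[of 1] by simp
  then have "2 * exp (- 1 :: real) \<le> 1" by (simp add: exp_minus field_simps)
  then have "2 * exp (- 1) * inverse ((real (r i))\<^sup>2) \<le> 1 * inverse ((real (r i))\<^sup>2)"
    by (intro mult_right_mono) auto
  with * show ?thesis by (simp add: C_def divide_inverse)
qed

text \<open>Each summand is a product over the variables, so the sum over all subsets factorises. A
  variable outside the support contributes at most 1 + 1 / r^2, one inside at most 1 + 1 / s with s
  = \<open>card S0\<close>. By 1 + x \<le> exp x and distinctness of the ranks, the product is at
  most exp (2 + 1).\<close>

lemma union_bound_sum:
  assumes S0: "S0 \<subseteq> {..<p}" "card S0 \<ge> 1" and r: "bij_betw r {..<p} {1..p}" and \<delta>: "0 < \<delta>" "\<delta> < 1"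
  shows "(\<Sum>S\<in>Pow {..<p}. 2 ^ (card (S - S0) + 1) * exp (- (union_const *
            ((\<Sum>i\<in>S - S0. code_len r i) + ln (real (card S0)) * real (card (S0 - S)) + ln (1 / \<delta>)))))
          \<le> 2 * exp 3 * \<delta>" (is "?L \<le> _")
proof -
  let ?K = union_const
  define s where "s = real (card S0)"
  have s: "s \<ge> 1" using S0(2) by (simp add: s_def)
  have fin0: "finite S0" using S0(1) finite_subset by blast
  \<comment> \<open>\<open>f\<close> is the factor of a variable that is selected, \<open>g\<close>
    that of a variable left out.\<close>
  define f where "f i = (if i \<in> S0 then 1 else 2 * exp (- ?K * code_len r i))" for i
  define g where "g i = (if i \<in> S0 then exp (- ?K * ln s) else 1)" for i
  have f_prod: "prod f S = 2 ^ card (S - S0) * exp (- ?K * (\<Sum>i\<in>S - S0. code_len r i))" if S: "S \<subseteq> {..<p}" for S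
  proof -
    have fin: "finite S" using S finite_subset by blast
    have "prod f S = (\<Prod>i\<in>S - S0. 2 * exp (- ?K * code_len r i))"
      using fin by (intro prod.mono_neutral_cong_right) (auto simp: f_def)
    also have "\<dots> = 2 ^ card (S - S0) * (\<Prod>i\<in>S - S0. exp (- ?K * code_len r i))"
      by (simp add: prod.distrib)
    also have "(\<Prod>i\<in>S - S0. exp (- ?K * code_len r i)) = exp (- ?K * (\<Sum>i\<in>S - S0. code_len r i))"
      using fin by (simp add: exp_sum sum_distrib_left)
    finally show ?thesis .
  qed
  have g_prod: "prod g ({..<p} - S) = exp (- ?K * (ln s * real (card (S0 - S))))" for S
  proof -
    have "prod g ({..<p} - S) = (\<Prod>i\<in>S0 - S. exp (- ?K * ln s))"
      using S0(1) by (intro prod.mono_neutral_cong_right) (auto simp: g_def)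
    also have "\<dots> = exp (- ?K * (ln s * real (card (S0 - S))))"
      by (simp add: ac_simps flip: exp_of_nat_mult)
    finally show ?thesis .
  qed
  have "?L = (\<Sum>S\<in>Pow {..<p}. 2 * exp (- ?K * ln (1 / \<delta>)) * (prod f S * prod g ({..<p} - S)))"
  proof (rule sum.cong)
    fix S assume "S \<in> Pow {..<p}"
    then have "S \<subseteq> {..<p}" by simp
    then show "2 ^ (card (S - S0) + 1) * exp (- (?K *
            ((\<Sum>i\<in>S - S0. code_len r i) + ln (real (card S0)) * real (card (S0 - S)) + ln (1 / \<delta>))))
        = 2 * exp (- ?K * ln (1 / \<delta>)) * (prod f S * prod g ({..<p} - S))"
      unfolding f_prod[OF \<open>S \<subseteq> {..<p}\<close>] g_prod
      by (simp add: s_def distrib_left exp_add exp_diff exp_minus field_simps)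
  qed simp
  also have "\<dots> = 2 * exp (- ?K * ln (1 / \<delta>)) * (\<Sum>S\<in>Pow {..<p}. prod f S * prod g ({..<p} - S))"
    by (simp add: sum_distrib_left)
  also have "(\<Sum>S\<in>Pow {..<p}. prod f S * prod g ({..<p} - S)) = (\<Prod>i<p. f i + g i)"
    by (rule prod_add[symmetric]) simp
  also have "2 * exp (- ?K * ln (1 / \<delta>)) * (\<Prod>i<p. f i + g i) \<le> 2 * \<delta> * exp 3"
  proof (rule mult_mono)
    \<comment> \<open>The confidence term contributes \<delta> to the power \<open>?K\<close>, which
      is at most \<delta> as \<open>?K\<close> exceeds 1.\<close>
    have "ln \<delta> * ?K \<le> ln \<delta> * 1"
      using union_const_ge_2 \<delta> by (intro mult_left_mono_neg) auto
    then have "exp (ln \<delta> * ?K) \<le> exp (ln \<delta>)" by (simp only: exp_le_cancel_iff mult_1_right)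
    also have "exp (ln \<delta> * ?K) = exp (- ?K * ln (1 / \<delta>))" using \<delta> by (simp add: ln_div mult.commute)
    finally show "2 * exp (- ?K * ln (1 / \<delta>)) \<le> 2 * \<delta>" using \<delta> by simp
    define h where "h i = (if i \<in> S0 then 1 / s else 1 / (real (r i))\<^sup>2)" for i
    have "(\<Prod>i<p. f i + g i) \<le> (\<Prod>i<p. exp (h i))"
    proof (intro prod_mono conjI)
      fix i assume i: "i \<in> {..<p}"
      show "0 \<le> f i + g i" by (simp add: f_def g_def)
      have "r i \<ge> 1" using bij_betwE[OF r] i by force
      have "f i + g i \<le> 1 + h i"
      proof (cases "i \<in> S0")
        case True
        have "1 * ln s \<le> ?K * ln s" using union_const_ge_2 s by (intro mult_right_mono) auto
        then have "exp (- ?K * ln s) \<le> exp (- ln s)" by simp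
        also have "\<dots> = 1 / s" using s by (simp add: exp_minus inverse_eq_divide)
        finally show ?thesis using True by (simp add: f_def g_def h_def)
      next
        case False
        then show ?thesis using exp_code_len_le[of r i] \<open>r i \<ge> 1\<close> by (simp add: f_def g_def h_def)
      qed
      then show "f i + g i \<le> exp (h i)" using exp_ge_add_one_self[of "h i"] by linarith
    qed
    also have "\<dots> = exp (\<Sum>i<p. h i)" by (simp add: exp_sum)
    \<comment> \<open>The rank terms are extended to all variables, so that the bijection onto
      \<open>{1..p}\<close> applies.\<close>
    also have "(\<Sum>i<p. h i) \<le> (\<Sum>i<p. (if i \<in> S0 then 1 / s else 0) + 1 / (real (r i))\<^sup>2)"
      by (intro sum_mono) (auto simp: h_def)
    also have "\<dots> = (\<Sum>i\<in>S0. 1 / s) + (\<Sum>i<p. 1 / (real (r i))\<^sup>2)"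
      using S0(1) by (simp add: sum.distrib sum.If_cases inf.absorb2 Int_absorb1)
    also have "\<dots> \<le> 1 + 2"
      using sum_inverse_ranks_le[OF r] s by (intro add_mono) (auto simp: s_def)
    finally show "(\<Prod>i<p. f i + g i) \<le> exp 3" by simp
  qed (use \<delta> in \<open>auto intro!: prod_nonneg simp: f_def g_def\<close>)
  finally show ?thesis by (simp add: ac_simps)
qed

section \<open>Comparing a candidate model with the true support\<close>

lemma is_onb_exists:
  assumes "finite S"
  obtains qs where "is_onb n qs (span_of n a S)"
  using is_onb_extend[OF assms, of "{}" n "[]" a] is_onb_empty by auto

lemma response_index:
  "X \<in> carrier_mat n p \<Longrightarrow> b \<in> carrier_vec p \<Longrightarrow> i < n \<Longrightarrow>
    response X b e w $ i = (\<Sum>j\<in>support b. X $$ (i, j) * b $ j) + e i w"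
  unfolding response_def
  by (auto simp: scalar_prod_def support_def intro!: sum.mono_neutral_right)

lemma response_carrier: "X \<in> carrier_mat n p \<Longrightarrow> response X b e w \<in> carrier_vec n"
  by (intro carrier_vecI) (simp add: response_def)

text \<open>\<open>B\<close> is the squared bias of S. Columns common to S and the support are
  fitted exactly, so only the missed ones enter it, and the restricted eigenvalue applies.
  \<open>Q\<close> and \<open>B\<close> are chosen before the noise, as a tail bound for a fixed
  system requires.\<close>

lemma RSS_response_diff:
  assumes X: "X \<in> carrier_mat n p" and b: "b \<in> carrier_vec p" and S: "S \<subseteq> {..<p}"
  defines "S0 \<equiv> support b"
  shows "\<exists>Q B. orthonormal n Q \<and> length Q \<le> card (S - S0) + 1 \<and> B \<ge> 0 \<and>
     lambda_min ((1 / real n) \<cdot>\<^sub>m (transpose_mat (col_sub X (S0 - S)) * resid_proj X S * col_sub X (S0 - S)))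
       * (\<Sum>j\<in>S0 - S. (b $ j)\<^sup>2) \<le> B / real n \<and>
     (\<forall>e w. B / 2 - 2 * proj_sq n Q (\<lambda>i. e i w)
        \<le> RSS X (response X b e w) S - RSS X (response X b e w) S0)"
proof -
  have S0: "S0 \<subseteq> {..<p}" using b by (auto simp: S0_def support_def)
  have fin: "finite S" "finite S0" using S S0 finite_subset by blast+
  define f where "f = (\<lambda>i. \<Sum>j\<in>S0. X $$ (i, j) * b $ j)"
  define fU where "fU = (\<lambda>i. \<Sum>j\<in>S0 - S. X $$ (i, j) * b $ j)"
  define fI where "fI = (\<lambda>i. \<Sum>j\<in>S \<inter> S0. X $$ (i, j) * b $ j)"
  let ?a = "mat_cols X"
  obtain qs where qs: "is_onb n qs (span_of n ?a (S \<inter> S0))" using is_onb_exists[of "S \<inter> S0"] fin by blast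
  obtain rs where rs: "length rs \<le> card (S - S0)" "is_onb n (rs @ qs) (span_of n ?a S)"
  proof -
    have "S \<inter> S0 \<union> (S - S0) = S" by auto
    then show thesis using is_onb_extend[OF _ _ _ qs, of "S - S0"] fin that by force
  qed
  obtain rs0 where rs0: "is_onb n (rs0 @ qs) (span_of n ?a S0)"
  proof -
    have "S \<inter> S0 \<union> (S0 - S) = S0" by auto
    then show thesis using is_onb_extend[OF _ _ _ qs, of "S0 - S"] fin that by force
  qed
  have f: "f \<in> span_of n ?a S0" by (auto simp: f_def span_of_def)
  have "fI \<in> span_of n ?a (S \<inter> S0)" by (auto simp: fI_def span_of_def)
  then have fI: "fI \<in> span_of n ?a S" using span_of_mono[of S "S \<inter> S0"] fin by blast
  have f_split: "f i = fU i + fI i" for i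
  proof -
    have "S0 = (S0 - S) \<union> (S \<inter> S0)" by auto
    then have "f i = (\<Sum>j\<in>(S0 - S) \<union> (S \<inter> S0). X $$ (i, j) * b $ j)" unfolding f_def by simp
    also have "\<dots> = fU i + fI i" unfolding fU_def fI_def using fin by (intro sum.union_disjoint) auto
    finally show ?thesis .
  qed
  let ?\<mu> = "residual n (rs @ qs) f"
  have \<mu>: "?\<mu> i = residual n (rs @ qs) fU i" if "i < n" for i
  proof -
    have "proj_onto n (rs @ qs) fI i = fI i" using rs(2) fI that by (simp add: is_onb_def)
    then show ?thesis
      using proj_onto_cong[of n f "\<lambda>i. fU i + fI i" "rs @ qs"] f_split by (simp add: residual_def proj_onto_add)
  qed
  obtain Q where Q: "orthonormal n Q" "length Q \<le> length rs + 1"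
    and Qb: "\<And>e y. (\<forall>i<n. y i = f i + e i) \<Longrightarrow>
      ip n ?\<mu> ?\<mu> / 2 - 2 * proj_sq n Q e
        \<le> ip n (residual n (rs @ qs) y) (residual n (rs @ qs) y) - ip n (residual n (rs0 @ qs) y) (residual n (rs0 @ qs) y)"
    using rss_diff_lower_bound[OF rs(2) rs0 f] by blast
  have "lambda_min ((1 / real n) \<cdot>\<^sub>m (transpose_mat (col_sub X (S0 - S)) * resid_proj X S * col_sub X (S0 - S)))
       * (\<Sum>j\<in>S0 - S. (b $ j)\<^sup>2) \<le> ip n (residual n (rs @ qs) fU) (residual n (rs @ qs) fU) / real n"
    unfolding fU_def using S0 by (intro lambda_min_le_residual[OF X S _ rs(2)]) auto
  also have "ip n (residual n (rs @ qs) fU) (residual n (rs @ qs) fU) = ip n ?\<mu> ?\<mu>"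
    by (intro ip_cong) (simp_all add: \<mu>)
  finally have lam: "lambda_min ((1 / real n) \<cdot>\<^sub>m (transpose_mat (col_sub X (S0 - S)) * resid_proj X S * col_sub X (S0 - S)))
       * (\<Sum>j\<in>S0 - S. (b $ j)\<^sup>2) \<le> ip n ?\<mu> ?\<mu> / real n" .
  have rss: "ip n ?\<mu> ?\<mu> / 2 - 2 * proj_sq n Q (\<lambda>i. e i w)
      \<le> RSS X (response X b e w) S - RSS X (response X b e w) S0" for e :: "nat \<Rightarrow> 'c \<Rightarrow> real" and w
  proof -
    let ?y = "response X b e w"
    have y: "?y \<in> carrier_vec n" by (rule response_carrier[OF X])
    show ?thesis
      unfolding RSS_eq[OF X S rs(2) y] RSS_eq[OF X S0 rs0 y]
      by (rule Qb) (simp add: response_index[OF X b] f_def S0_def)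
  qed
  show ?thesis
    using Q rs(1) lam rss ip_self_nonneg[of n ?\<mu>] by (intro exI[of _ Q] exI[of _ "ip n ?\<mu> ?\<mu>"]) auto
qed

text \<open>Through an orthonormal basis the residual sum of squares becomes a polynomial in the
  noise. This serves the measurability of the selection event.\<close>

lemma borel_measurable_DCIC_response:
  assumes X: "X \<in> carrier_mat n p" and b: "b \<in> carrier_vec p" and S: "S \<subseteq> {..<p}"
    and e: "\<And>i. i < n \<Longrightarrow> e i \<in> borel_measurable M"
  shows "(\<lambda>w. DCIC X r \<sigma> \<eta> l (response X b e w) S) \<in> borel_measurable M"
proof -
  define y where "y w i = (\<Sum>j\<in>support b. X $$ (i, j) * b $ j) + e i w" for w i
  obtain qs where qs: "is_onb n qs (span_of n (mat_cols X) S)"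
    using is_onb_exists[of S] S finite_subset by blast
  have on: "orthonormal n qs" using qs by (simp add: is_onb_def)
  have y_meas: "(\<lambda>w. y w i) \<in> borel_measurable M" if "i < n" for i
    using e[OF that] unfolding y_def by measurable
  have "RSS X (response X b e w) S = ip n (y w) (y w) - proj_sq n qs (y w)" for w
  proof -
    have eq: "response X b e w $ i = y w i" if "i < n" for i
      using that by (simp add: response_index[OF X b] y_def)
    have "RSS X (response X b e w) S = ip n (residual n qs (y w)) (residual n qs (y w))"
      unfolding RSS_eq[OF X S qs response_carrier[OF X]]
      using proj_onto_cong[of n "\<lambda>i. response X b e w $ i" "y w" qs] eq
      by (intro ip_cong) (simp_all add: residual_def)
    then show ?thesis by (simp add: norm_residual[OF on])
  qed
  moreover have "(\<lambda>w. ip n (y w) (y w)) \<in> borel_measurable M"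
    unfolding ip_def using y_meas by (intro borel_measurable_sum borel_measurable_times) auto
  moreover have "(\<lambda>w. proj_sq n qs (y w)) \<in> borel_measurable M"
    by (rule borel_measurable_proj_sq) (rule y_meas)
  ultimately show ?thesis unfolding DCIC_def by simp
qed

section \<open>The selection inequality\<close>

lemma omega_min_le_lambda_min:
  assumes X: "X \<in> carrier_mat n p" and S0: "S0 \<subseteq> {..<p}" and l: "finite Lam" "l \<in> Lam"
    and S: "S \<in> L_set lz p r \<eta> L \<delta> S0 l"
  shows "omega_min lz X r \<eta> L \<delta> S0 Lam \<le> lambda_min ((1 / real n) \<cdot>\<^sub>m
          (transpose_mat (col_sub X (S0 - S)) * resid_proj X S * col_sub X (S0 - S)))"
proof -
  have dims: "dim_row X = n" "dim_col X = p" using X by simp_all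
  have "L_set lz p r \<eta> L \<delta> S0 l \<subseteq> Pow {..<p}"
    using S0 by (auto simp: L_set_def M_sub_def M_wrong_def)
  then have "finite (L_set lz p r \<eta> L \<delta> S0 l)" by (rule finite_subset) simp
  then have "omega lz X r \<eta> L \<delta> S0 l \<le> lambda_min ((1 / real n) \<cdot>\<^sub>m
          (transpose_mat (col_sub X (S0 - S)) * resid_proj X S * col_sub X (S0 - S)))"
    unfolding omega_def dims using S by (intro cINF_lower bdd_below_finite finite_imageI)
  moreover have "omega_min lz X r \<eta> L \<delta> S0 Lam \<le> omega lz X r \<eta> L \<delta> S0 l"
    unfolding omega_min_def using l by (intro Min_le) auto
  ultimately show ?thesis by linarith
qed

lemma beta_min_sum_le:
  assumes "finite (support b)"
  shows "(beta_min b)\<^sup>2 * real (card (support b - S)) \<le> (\<Sum>j\<in>support b - S. (b $ j)\<^sup>2)"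
proof -
  have "(beta_min b)\<^sup>2 \<le> (b $ j)\<^sup>2" if j: "j \<in> support b - S" for j
  proof -
    have "beta_min b \<le> \<bar>b $ j\<bar>" unfolding beta_min_def using assms j by (intro Min_le) auto
    moreover have "beta_min b \<ge> 0"
      unfolding beta_min_def using assms j by (subst Min_ge_iff) auto
    ultimately show ?thesis by (metis power2_abs power_mono)
  qed
  then have "(\<Sum>j\<in>support b - S. (beta_min b)\<^sup>2) \<le> (\<Sum>j\<in>support b - S. (b $ j)\<^sup>2)"
    by (rule sum_mono)
  then show ?thesis by (simp add: mult.commute)
qed

lemma sum_diff_sets:
  fixes g :: "'a \<Rightarrow> real"
  assumes "finite S" "finite T"
  shows "sum g S - sum g T = sum g (S - T) - sum g (T - S)"
proof -
  have "sum g S = sum g (S - T) + sum g (S \<inter> T)" "sum g T = sum g (T - S) + sum g (S \<inter> T)"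
    using assms by (metis add.commute sum.Int_Diff, metis Int_commute add.commute sum.Int_Diff)
  then show ?thesis by simp
qed

text \<open>The deterministic part, with \<open>B\<close> for the squared bias and \<open>V\<close>
  for the squared projected noise. Of the weight \<open>l\<close> on the code length of the false
  positives, \<open>lz\<close> pays for the noise and \<open>l - lz\<close> remains in the
  conclusion.\<close>

lemma minimizer_bound:
  fixes L :: nat
  assumes X: "X \<in> carrier_mat n p" and b: "b \<in> carrier_vec p" and card0: "card (support b) \<ge> 1"
    and \<sigma>: "\<sigma> > 0" and \<delta>: "0 < \<delta>" and L: "L \<ge> 1" and lz: "lz > 0" and l: "finite Lam" "l \<in> Lam" "lz \<le> l"
    and \<omega>: "omega_min lz X r \<eta> L \<delta> (support b) Lam > 0"
    and S: "S \<subseteq> {..<p}" and min: "DCIC X r \<sigma> \<eta> l y S \<le> DCIC X r \<sigma> \<eta> l y (support b)"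
    and B: "B \<ge> 0"
    and lam: "lambda_min ((1 / real n) \<cdot>\<^sub>m (transpose_mat (col_sub X (support b - S)) * resid_proj X S * col_sub X (support b - S)))
       * (\<Sum>j\<in>support b - S. (b $ j)\<^sup>2) \<le> B / real n"
    and rss: "B / 2 - 2 * V \<le> RSS X y S - RSS X y (support b)"
    and noise: "2 * V / \<sigma>\<^sup>2 \<le> lz * ((\<Sum>i\<in>S - support b. code_len r i)
        + ln (real (card (support b))) * real (card (support b - S)) + ln (1 / \<delta>))"
  shows "(\<eta> + (l - lz) * C_min r p (support b)) * false_pos (support b) S
          + (real n / (2 * \<sigma>\<^sup>2) * omega_min lz X r \<eta> L \<delta> (support b) Lam * (beta_min b)\<^sup>2
             - \<eta> - l * C_max r (support b) - lz * ln (real (card (support b)))) * false_neg (support b) S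
          \<le> lz * ln (real L / \<delta>)"
proof -
  define S0 where "S0 = support b"
  define \<Delta>p where "\<Delta>p = false_pos S0 S"
  define \<Delta>m where "\<Delta>m = false_neg S0 S"
  define c where "c = lz * ln (real (card S0))"
  define \<omega>m where "\<omega>m = omega_min lz X r \<eta> L \<delta> S0 Lam"
  have S0: "S0 \<subseteq> {..<p}" using b by (auto simp: S0_def support_def)
  have fin: "finite S" "finite S0" using S S0 finite_subset by blast+
  \<comment> \<open>If the support contains all variables, the sum is empty and the value of
    \<open>C_min\<close> does not matter.\<close>
  have Cp: "C_min r p S0 * \<Delta>p \<le> (\<Sum>i\<in>S - S0. code_len r i)"
  proof -
    have "(\<Sum>i\<in>S - S0. C_min r p S0) \<le> (\<Sum>i\<in>S - S0. code_len r i)"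
      using S by (intro sum_mono) (auto simp: C_min_def intro!: Min_le)
    then show ?thesis by (simp add: \<Delta>p_def false_pos_def mult.commute)
  qed
  have Cm: "(\<Sum>i\<in>S0 - S. code_len r i) \<le> C_max r S0 * \<Delta>m"
  proof -
    have "(\<Sum>i\<in>S0 - S. code_len r i) \<le> (\<Sum>i\<in>S0 - S. C_max r S0)"
      using fin by (intro sum_mono) (auto simp: C_max_def intro!: Max_ge)
    then show ?thesis by (simp add: \<Delta>m_def false_neg_def mult.commute)
  qed
  have card_diff: "real (card S) - real (card S0) = \<Delta>p - \<Delta>m"
    using sum_diff_sets[OF fin, of "\<lambda>_. 1"] by (simp add: \<Delta>p_def \<Delta>m_def false_pos_def false_neg_def)
  have "(B / 2 - 2 * V) / \<sigma>\<^sup>2 \<le> (RSS X y S - RSS X y S0) / \<sigma>\<^sup>2"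
    using rss by (intro divide_right_mono) (auto simp: S0_def)
  also have "\<dots> \<le> \<eta> * real (card S0) - \<eta> * real (card S)
      + l * ((\<Sum>i\<in>S0. code_len r i) - (\<Sum>i\<in>S. code_len r i))"
    using min by (simp add: DCIC_def S0_def diff_divide_distrib algebra_simps)
  also have "\<dots> = \<eta> * (\<Delta>m - \<Delta>p) + l * ((\<Sum>i\<in>S0 - S. code_len r i) - (\<Sum>i\<in>S - S0. code_len r i))"
    using card_diff sum_diff_sets[OF fin(2,1), of "code_len r"] by (simp flip: right_diff_distrib)
  finally have 1: "B / (2 * \<sigma>\<^sup>2) - 2 * V / \<sigma>\<^sup>2 \<le> \<eta> * (\<Delta>m - \<Delta>p)
      + l * (\<Sum>i\<in>S0 - S. code_len r i) - l * (\<Sum>i\<in>S - S0. code_len r i)"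
    by (simp add: diff_divide_distrib algebra_simps)
  have 2: "2 * V / \<sigma>\<^sup>2 \<le> lz * (\<Sum>i\<in>S - S0. code_len r i) + c * \<Delta>m + lz * ln (1 / \<delta>)"
    using noise by (simp add: S0_def c_def \<Delta>m_def false_neg_def algebra_simps)
  \<comment> \<open>The noise bound is uniform in \<lambda>, so the grid size L enters only through
    this weakening.\<close>
  have 3: "lz * ln (1 / \<delta>) \<le> lz * ln (real L / \<delta>)"
    using lz \<delta> L by (intro mult_left_mono) (auto simp: ln_div)
  have 4: "l * (\<Sum>i\<in>S0 - S. code_len r i) \<le> l * (C_max r S0 * \<Delta>m)"
    using Cm l(3) lz by (intro mult_left_mono) auto
  have 5: "(l - lz) * (C_min r p S0 * \<Delta>p) \<le> (l - lz) * (\<Sum>i\<in>S - S0. code_len r i)"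
    using Cp l(3) by (intro mult_left_mono) auto
  have main: "B / (2 * \<sigma>\<^sup>2) + (\<eta> + (l - lz) * C_min r p S0) * \<Delta>p - (\<eta> + l * C_max r S0 + c) * \<Delta>m
      \<le> lz * ln (real L / \<delta>)"
    using 1 2 3 4 5 by (simp add: algebra_simps)
  have bias: "real n / (2 * \<sigma>\<^sup>2) * \<omega>m * (beta_min b)\<^sup>2 * \<Delta>m \<le> B / (2 * \<sigma>\<^sup>2)"
  proof (cases "S0 \<subseteq> S")
    case True
    then have "\<Delta>m = 0" unfolding \<Delta>m_def false_neg_def by (metis Diff_eq_empty_iff card.empty of_nat_0)
    then show ?thesis using B by simp
  next
    case False
    have "0 \<le> B / (2 * \<sigma>\<^sup>2)" using B by simp
    \<comment> \<open>Dropping the bias leaves precisely the inequality that defines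
      \<open>L_set\<close>; only after that may the bias be bounded below by
      \<open>omega_min\<close>.\<close>
    then have "(\<eta> + (l - lz) * C_min r p S0) * \<Delta>p - (\<eta> + l * C_max r S0 + c) * \<Delta>m \<le> lz * ln (real L / \<delta>)"
      using main by linarith
    then have "S \<in> L_set lz p r \<eta> L \<delta> S0 l"
      using False S by (auto simp: L_set_def M_sub_def M_wrong_def \<Delta>p_def \<Delta>m_def c_def)
    note \<omega>_le = omega_min_le_lambda_min[OF X S0 l(1,2) this]
    have "\<omega>m * ((beta_min b)\<^sup>2 * \<Delta>m) \<le> \<omega>m * (\<Sum>j\<in>S0 - S. (b $ j)\<^sup>2)"
      using \<omega> beta_min_sum_le[of b S] fin
      by (intro mult_left_mono) (auto simp: \<omega>m_def S0_def \<Delta>m_def false_neg_def)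
    also have "\<dots> \<le> B / real n"
      using mult_right_mono[OF \<omega>_le, of "\<Sum>j\<in>S0 - S. (b $ j)\<^sup>2"] lam
      by (simp add: \<omega>m_def S0_def sum_nonneg)
    finally have "\<omega>m * ((beta_min b)\<^sup>2 * \<Delta>m) \<le> B / real n" .
    \<comment> \<open>For n = 0 the quotient \<open>B / real n\<close> says nothing, but then the
      left side is 0.\<close>
    then have "real n * (\<omega>m * ((beta_min b)\<^sup>2 * \<Delta>m)) \<le> B"
      using B by (cases "n = 0") (simp_all add: field_simps)
    then have "real n * (\<omega>m * ((beta_min b)\<^sup>2 * \<Delta>m)) / (2 * \<sigma>\<^sup>2) \<le> B / (2 * \<sigma>\<^sup>2)"
      by (intro divide_right_mono) auto
    then show ?thesis by (simp add: algebra_simps)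
  qed
  from main bias have "(\<eta> + (l - lz) * C_min r p S0) * \<Delta>p
      + (real n / (2 * \<sigma>\<^sup>2) * \<omega>m * (beta_min b)\<^sup>2 - \<eta> - l * C_max r S0 - c) * \<Delta>m \<le> lz * ln (real L / \<delta>)"
    by (simp add: algebra_simps)
  then show ?thesis by (simp add: S0_def \<Delta>p_def \<Delta>m_def c_def \<omega>m_def)
qed

section \<open>The high-probability event\<close>

text \<open>\<kappa> is fixed before the probability space, n, \<sigma> and the noise; through it
  the final constant depends on \<zeta> alone.\<close>

lemma noise_model_mgf:
  fixes M :: "'w measure"
  assumes \<zeta>: "\<zeta> > 0"
  obtains \<kappa> where "\<kappa> > 0"
    "\<And>(M :: 'w measure) n \<sigma> e v. noise_model \<zeta> M n \<sigma> e \<Longrightarrow> \<sigma> > 0 \<Longrightarrow>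
       (\<integral>\<^sup>+w. exp (ip n v (\<lambda>i. e i w / \<sigma>)) \<partial>M) \<le> ennreal (exp (\<kappa> * ip n v v))"
proof -
  define a where "a = 1 / (4 * \<zeta>\<^sup>2)"
  define B where "B = exp (1 / \<zeta>\<^sup>2) + 2 / (1 - exp (- a))"
  have a: "a > 0" using \<zeta> by (simp add: a_def)
  have "B > 0" using a by (auto simp: B_def intro!: add_pos_pos)
  have "(\<integral>\<^sup>+w. exp (ip n v (\<lambda>i. e i w / \<sigma>)) \<partial>M) \<le> ennreal (exp ((B / a + 1 / a) * ip n v v))"
    if nm: "noise_model \<zeta> M n \<sigma> e" and \<sigma>: "\<sigma> > 0" for M :: "'w measure" and n \<sigma> e v
  proof -
    interpret prob_space M using nm by (simp add: noise_model_def)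
    have indep: "indep_vars (\<lambda>_. borel) e {..<n}" using nm by (simp add: noise_model_def)
    have indep': "indep_vars (\<lambda>_. borel) (\<lambda>i w. e i w / \<sigma>) {..<n}"
      by (rule indep_vars_compose2[OF indep]) simp
    show ?thesis
    proof (rule indep_ip_mgf[OF indep'])
      fix i s assume i: "i < n"
      have meas: "e i \<in> borel_measurable M" using indep i by (simp add: indep_vars_def)
      have *: "integrable M (e i)" "expectation (e i) = 0"
        "\<And>t. t \<ge> 2 \<Longrightarrow> prob {w \<in> space M. \<bar>e i w / \<sigma>\<bar> > t} \<le> 2 * exp (- (t / \<zeta>)\<^sup>2)"
        using nm i by (auto simp: noise_model_def)
      have "(\<integral>\<^sup>+w. exp (a * (e i w / \<sigma>)\<^sup>2) \<partial>M) \<le> ennreal B"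
        using exp_square_moment[of "\<lambda>w. e i w / \<sigma>", OF _ \<zeta> *(3)] meas
        by (simp add: a_def B_def)
      then show "(\<integral>\<^sup>+w. exp (s * (e i w / \<sigma>)) \<partial>M) \<le> ennreal (exp ((B / a + 1 / a) * s\<^sup>2))"
        using meas * a by (intro subgaussian_mgf) auto
    qed
  qed
  then show thesis using a \<open>B > 0\<close> by (intro that[of "B / a + 1 / a"]) (auto intro: add_pos_pos)
qed

lemma proj_sq_scale: "proj_sq n qs (\<lambda>i. v i / c) = proj_sq n qs v / c\<^sup>2"
proof -
  have "ip n q (\<lambda>i. v i / c) = ip n q v / c" for q
    using ip_scale_right[of n q "1 / c" v] by simp
  then show ?thesis by (induction qs) (simp_all add: power_divide add_divide_distrib)
qed

text \<open>In \<open>lz\<close>, the 8 \<kappa> is the scale of \<open>proj_sq_tail\<close>, its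
  doubling comes from the factor 2 before the noise in the residual comparison, and
  \<open>union_const\<close> makes the exponents summable over all models.\<close>

lemma (in prob_space) selection_inequality_prob:
  fixes L :: nat
  assumes X: "X \<in> carrier_mat n p" and b: "b \<in> carrier_vec p" and card0: "card (support b) \<ge> 1"
    and \<sigma>: "\<sigma> > 0" and r: "bij_betw r {..<p} {1..p}" and \<delta>: "0 < \<delta>" "\<delta> < 1" and L: "L \<ge> 1"
    and e[measurable]: "\<And>i. i < n \<Longrightarrow> e i \<in> borel_measurable M" and \<kappa>: "\<kappa> > 0"
    and mgf: "\<And>v. (\<integral>\<^sup>+w. exp (ip n v (\<lambda>i. e i w / \<sigma>)) \<partial>M) \<le> ennreal (exp (\<kappa> * ip n v v))"
  defines "lz \<equiv> 16 * \<kappa> * union_const"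
  assumes Lam: "finite Lam" "Lam \<subseteq> {lz..}" and \<omega>: "omega_min lz X r \<eta> L \<delta> (support b) Lam > 0"
  shows "prob {w \<in> space M. \<forall>l\<in>Lam. \<forall>S.
        is_arg_min (DCIC X r \<sigma> \<eta> l (response X b e w)) (\<lambda>S. S \<subseteq> {..<p}) S \<longrightarrow>
          (\<eta> + (l - lz) * C_min r p (support b)) * false_pos (support b) S
          + (real n / (2 * \<sigma>\<^sup>2) * omega_min lz X r \<eta> L \<delta> (support b) Lam * (beta_min b)\<^sup>2
             - \<eta> - l * C_max r (support b) - lz * ln (real (card (support b))))
            * false_neg (support b) S
          \<le> lz * ln (real L / \<delta>)}
      \<ge> 1 - 2 * exp 3 * \<delta>"
proof -
  have lz: "lz > 0" using \<kappa> union_const_ge_2 by (simp add: lz_def)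
  define S0 where "S0 = support b"
  define \<Phi> where "\<Phi> l S \<longleftrightarrow> (\<eta> + (l - lz) * C_min r p S0) * false_pos S0 S
        + (real n / (2 * \<sigma>\<^sup>2) * omega_min lz X r \<eta> L \<delta> S0 Lam * (beta_min b)\<^sup>2
           - \<eta> - l * C_max r S0 - lz * ln (real (card S0))) * false_neg S0 S
        \<le> lz * ln (real L / \<delta>)" for l S
  define D where "D l w = DCIC X r \<sigma> \<eta> l (response X b e w)" for l w
  define E where "E = {w \<in> space M. \<forall>l\<in>Lam. \<forall>S. is_arg_min (D l w) (\<lambda>S. S \<subseteq> {..<p}) S \<longrightarrow> \<Phi> l S}"
  have S0: "S0 \<subseteq> {..<p}" using b by (auto simp: S0_def support_def)
  have D_meas[measurable]: "(\<lambda>w. D l w S) \<in> borel_measurable M" if "S \<in> Pow {..<p}" for l S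
    unfolding D_def using that e by (intro borel_measurable_DCIC_response[OF X b]) auto
  have fin: "finite (Pow {..<p})" by simp
  \<comment> \<open>Being a minimiser is a comparison of finitely many measurable functions, and
    with a finite grid the event becomes measurable.\<close>
  have E_eq: "E = {w \<in> space M. \<forall>l\<in>Lam. \<forall>S\<in>Pow {..<p}. (\<exists>S'\<in>Pow {..<p}. D l w S' < D l w S) \<or> \<Phi> l S}"
  proof -
    have "is_arg_min (D l w) (\<lambda>S. S \<subseteq> {..<p}) S
        \<longleftrightarrow> S \<in> Pow {..<p} \<and> \<not> (\<exists>S'\<in>Pow {..<p}. D l w S' < D l w S)" for l w S
      by (auto simp: is_arg_min_def)
    then show ?thesis unfolding E_def by blast
  qed
  have E_meas: "E \<in> sets M"
    unfolding E_eq
    by (intro sets.sets_Collect_finite_All sets.sets_Collect_finite_Ex sets.sets_Collect_disj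
          sets.sets_Collect_const borel_measurable_less D_meas fin Lam(1)) auto
  define xS where "xS S = union_const * ((\<Sum>i\<in>S - S0. code_len r i)
      + ln (real (card S0)) * real (card (S0 - S)) + ln (1 / \<delta>))" for S
  have "\<forall>S\<in>Pow {..<p}. \<exists>Q B. orthonormal n Q \<and> length Q \<le> card (S - S0) + 1 \<and> B \<ge> 0 \<and>
     lambda_min ((1 / real n) \<cdot>\<^sub>m (transpose_mat (col_sub X (S0 - S)) * resid_proj X S * col_sub X (S0 - S)))
       * (\<Sum>j\<in>S0 - S. (b $ j)\<^sup>2) \<le> B / real n \<and>
     (\<forall>w. B / 2 - 2 * proj_sq n Q (\<lambda>i. e i w)
        \<le> RSS X (response X b e w) S - RSS X (response X b e w) S0)" (is "\<forall>S\<in>_. ?P S")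
  proof
    fix S assume "S \<in> Pow {..<p}"
    then have "S \<subseteq> {..<p}" by simp
    from RSS_response_diff[OF X b this] obtain Q B where "orthonormal n Q \<and> length Q \<le> card (S - S0) + 1 \<and> B \<ge> 0 \<and>
     lambda_min ((1 / real n) \<cdot>\<^sub>m (transpose_mat (col_sub X (S0 - S)) * resid_proj X S * col_sub X (S0 - S)))
       * (\<Sum>j\<in>S0 - S. (b $ j)\<^sup>2) \<le> B / real n"
      and "\<And>(e :: nat \<Rightarrow> 'a \<Rightarrow> real) w. B / 2 - 2 * proj_sq n Q (\<lambda>i. e i w)
        \<le> RSS X (response X b e w) S - RSS X (response X b e w) S0"
      unfolding S0_def by blast
    then show "?P S" by (intro exI[of _ Q] exI[of _ B]) simp
  qed
  then obtain Q B where QB: "\<And>S. S \<subseteq> {..<p} \<Longrightarrow> orthonormal n (Q S) \<and> length (Q S) \<le> card (S - S0) + 1 \<and> B S \<ge> 0 \<and>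
     lambda_min ((1 / real n) \<cdot>\<^sub>m (transpose_mat (col_sub X (S0 - S)) * resid_proj X S * col_sub X (S0 - S)))
       * (\<Sum>j\<in>S0 - S. (b $ j)\<^sup>2) \<le> B S / real n \<and>
     (\<forall>w. B S / 2 - 2 * proj_sq n (Q S) (\<lambda>i. e i w)
        \<le> RSS X (response X b e w) S - RSS X (response X b e w) S0)"
    by (metis PowI)
  \<comment> \<open>The bad event of a model involves no \<lambda>, so one union over models serves
    the whole grid and every choice among tied minimisers.\<close>
  define Bad where "Bad S = {w \<in> space M. proj_sq n (Q S) (\<lambda>i. e i w / \<sigma>) > 8 * \<kappa> * xS S}" for S
  have Bad_meas: "Bad S \<in> sets M" for S
    unfolding Bad_def by (intro borel_measurable_less borel_measurable_proj_sq) auto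
  have Bad_prob: "prob (Bad S) \<le> 2 ^ (card (S - S0) + 1) * exp (- xS S)" if S: "S \<in> Pow {..<p}" for S
  proof -
    have "prob (Bad S) \<le> 2 ^ length (Q S) * exp (- xS S)"
      unfolding Bad_def using QB[of S] S
      by (intro proj_sq_tail[OF _ \<kappa> mgf]) auto
    also have "\<dots> \<le> 2 ^ (card (S - S0) + 1) * exp (- xS S)"
      using QB[of S] S by (intro mult_right_mono power_increasing) auto
    finally show ?thesis .
  qed
  have "prob (\<Union>S\<in>Pow {..<p}. Bad S) \<le> (\<Sum>S\<in>Pow {..<p}. prob (Bad S))"
    using Bad_meas by (intro finite_measure_subadditive_finite) auto
  also have "\<dots> \<le> (\<Sum>S\<in>Pow {..<p}. 2 ^ (card (S - S0) + 1) * exp (- xS S))"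
    by (intro sum_mono Bad_prob)
  also have "\<dots> \<le> 2 * exp 3 * \<delta>"
    unfolding xS_def using card0 by (intro union_bound_sum[OF S0 _ r \<delta>]) (simp add: S0_def)
  finally have Bad: "prob (\<Union>S\<in>Pow {..<p}. Bad S) \<le> 2 * exp 3 * \<delta>" .
  have "space M - (\<Union>S\<in>Pow {..<p}. Bad S) \<subseteq> E"
  proof
    fix w assume w: "w \<in> space M - (\<Union>S\<in>Pow {..<p}. Bad S)"
    have "\<Phi> l S" if l: "l \<in> Lam" and am: "is_arg_min (D l w) (\<lambda>S. S \<subseteq> {..<p}) S" for l S
    proof -
      have S: "S \<subseteq> {..<p}" and le: "D l w S \<le> D l w S0"
        using am S0 by (auto simp: is_arg_min_def not_less)
      have "proj_sq n (Q S) (\<lambda>i. e i w / \<sigma>) \<le> 8 * \<kappa> * xS S"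
        using w S by (auto simp: Bad_def not_less)
      then have "2 * proj_sq n (Q S) (\<lambda>i. e i w) / \<sigma>\<^sup>2 \<le> lz * (xS S / union_const)"
        using union_const_ge_2 by (simp add: proj_sq_scale lz_def)
      also have "xS S / union_const = (\<Sum>i\<in>S - S0. code_len r i)
          + ln (real (card S0)) * real (card (S0 - S)) + ln (1 / \<delta>)"
        using union_const_ge_2 by (simp add: xS_def)
      finally have noise: "2 * proj_sq n (Q S) (\<lambda>i. e i w) / \<sigma>\<^sup>2 \<le> lz * ((\<Sum>i\<in>S - S0. code_len r i)
          + ln (real (card S0)) * real (card (S0 - S)) + ln (1 / \<delta>))" .
      have "lz \<le> l" using Lam l by auto
      then show ?thesis
        unfolding \<Phi>_def S0_def
        using minimizer_bound[OF X b card0 \<sigma> \<delta>(1) L lz Lam(1) l _ _ S, of r \<eta> "response X b e w" "B S" "proj_sq n (Q S) (\<lambda>i. e i w)"]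
          QB[OF S] noise le \<omega> by (simp add: S0_def D_def)
    qed
    then show "w \<in> E" using w by (simp add: E_def)
  qed
  then have "prob (space M - (\<Union>S\<in>Pow {..<p}. Bad S)) \<le> prob E"
    by (rule finite_measure_mono[OF _ E_meas])
  moreover have "prob (space M - (\<Union>S\<in>Pow {..<p}. Bad S)) = 1 - prob (\<Union>S\<in>Pow {..<p}. Bad S)"
    using Bad_meas by (intro prob_compl) auto
  ultimately have "prob E \<ge> 1 - 2 * exp 3 * \<delta>" using Bad by linarith
  then show ?thesis by (simp add: E_def D_def \<Phi>_def S0_def)
qed

theorem theorem5p3:
  shows "\<exists>c>0. \<forall>\<zeta>>0. \<exists>lz>0.
    \<forall>(M :: 'w measure) n p X b \<sigma> e r \<eta> \<delta> L (lam :: nat \<Rightarrow> real).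
      X \<in> carrier_mat n p \<longrightarrow>
      b \<in> carrier_vec p \<longrightarrow>
      card (support b) \<ge> 1 \<longrightarrow>
      \<sigma> > 0 \<longrightarrow>
      noise_model \<zeta> M n \<sigma> e \<longrightarrow>
      bij_betw r {..<p} {1..p} \<longrightarrow>
      \<eta> > 0 \<longrightarrow>
      0 < \<delta> \<longrightarrow> \<delta> < 1 \<longrightarrow>
      L \<ge> 1 \<longrightarrow>
      strict_antimono_on {1..L} lam \<longrightarrow>
      lam ` {1..L} \<subseteq> {lz..} \<longrightarrow>
      omega_min lz X r \<eta> L \<delta> (support b) (lam ` {1..L}) > 0 \<longrightarrow>
      prob_space.prob M {w \<in> space M. \<forall>l\<in>lam ` {1..L}. \<forall>S.
        is_arg_min (DCIC X r \<sigma> \<eta> l (response X b e w)) (\<lambda>S. S \<subseteq> {..<p}) S \<longrightarrow>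
          (\<eta> + (l - lz) * C_min r p (support b)) * false_pos (support b) S
          + (real n / (2 * \<sigma>\<^sup>2)
               * omega_min lz X r \<eta> L \<delta> (support b) (lam ` {1..L}) * (beta_min b)\<^sup>2
             - \<eta> - l * C_max r (support b) - lz * ln (real (card (support b))))
            * false_neg (support b) S
          \<le> lz * ln (real L / \<delta>)}
      \<ge> 1 - c * \<delta>"
  (is "\<exists>c>0. \<forall>\<zeta>>0. \<exists>lz>0. ?P c \<zeta> lz")
\<comment> \<open>\<open>c\<close> is the constant of \<open>union_bound_sum\<close>, independent
  even of \<zeta>.\<close>
proof (rule exI[of _ "2 * exp 3"], intro conjI allI impI)
  fix \<zeta> :: real assume "\<zeta> > 0"
  then obtain \<kappa> where \<kappa>: "\<kappa> > 0"
    and mgf: "\<And>(M :: 'w measure) n \<sigma> e v. noise_model \<zeta> M n \<sigma> e \<Longrightarrow> \<sigma> > 0 \<Longrightarrow>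
       (\<integral>\<^sup>+w. exp (ip n v (\<lambda>i. e i w / \<sigma>)) \<partial>M) \<le> ennreal (exp (\<kappa> * ip n v v))"
    using noise_model_mgf[where ?'w = 'w] by blast
  show "\<exists>lz>0. ?P (2 * exp 3) \<zeta> lz"
  proof (intro exI[of _ "16 * \<kappa> * union_const"] conjI allI impI, goal_cases)
    case 1
    show ?case using \<kappa> union_const_ge_2 by simp
  next
    case (2 M n p X b \<sigma> e r \<eta> \<delta> L lam)
    then have "prob_space M" "\<And>i. i < n \<Longrightarrow> e i \<in> borel_measurable M"
      by (auto simp: noise_model_def prob_space.indep_vars_def)
    then show ?case
      using 2 \<kappa> mgf[OF 2(5,4)] by (intro prob_space.selection_inequality_prob) auto
  qed
qed simp

end
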